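(* Let $K$ and $L$ be convex bodies in $\mathbb{R}^n$ containing the origin in their interior. Then $$\int_{\mathbb{S}^{n-1}} \ln \left( \frac{h_K}{h_L} \right)\, d\bar{v}_1 \;\geq\; \ln \left( \frac{V_1(L,K)}{\mathrm{Vol}(L)} \right) \;\geq\; \frac{1}{n} \ln \left( \frac{\mathrm{Vol}(K)}{\mathrm{Vol}(L)} \right).$$ Equality holds if and only if $K$ is homothetic to $L$.
   Context: A convex body in $\mathbb{R}^n$ is a compact convex set. $\mathrm{Vol}$ denotes $n$-dimensional Lebesgue measure. For a convex body $K$ containing the origin in its interior, $h_K(u)=\max\{x\cdot u : x\in K\}$, $u\in\mathbb{S}^{n-1}$, is its support function. $S_L$ denotes the surface area measure of $L$ on the unit sphere $\mathbb{S}^{n-1}$. The mixed volume measure of $K$ and $L$ is the measure $dv_1=\frac{1}{n}\,h_K\,dS_L$ on $\mathbb{S}^{n-1}$; its total mass is the mixed volume $V_1(L,K)=\frac1n\int_{\mathbb{S}^{n-1}}h_K\,dS_L$ (with $n-1$ copies of $L$ and one copy of $K$), and its normalization is the probability measure $d\bar{v}_1=\frac{1}{V_1(L,K)}\,dv_1$.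
   Formalization: "Homothetic" is taken as K = cL with c > 0 (no translation) and equality as equality throughout the chain; with translates allowed, "if" fails: L = [-1,1], K = [-1/2,3/2] gives strict first inequality. *)

theory Defs
  imports "HOL-Analysis.Analysis"
begin

text \<open>The ambient space is an arbitrary Euclidean space \<open>'a\<close>; its dimension
  \<open>n\<close> is \<open>DIM('a)\<close>.\<close>

definition convex_body :: "'a::euclidean_space set \<Rightarrow> bool"
  where "convex_body K \<longleftrightarrow> compact K \<and> convex K"

abbreviation Vol :: "'a::euclidean_space set \<Rightarrow> real"
  where "Vol K \<equiv> measure lebesgue K"

text \<open>For a nonempty compact set the supremum is attained, so it is a maximum.\<close>

definition support_fun :: "'a::euclidean_space set \<Rightarrow> 'a \<Rightarrow> real"
  where "support_fun K u = (SUP x\<in>K. x \<bullet> u)"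

text \<open>The surface area measure is the area measure of order \<open>n - 1\<close> in the sense of
  Fenchel and Jessen (see Schneider, Convex Bodies: The Brunn-Minkowski Theory, Section 4.2).
  For a Borel set \<open>\<omega>\<close> of unit vectors, the local parallel set of \<open>L\<close> consists of the
  points outside \<open>L\<close> at distance at most \<open>\<rho>\<close> from \<open>L\<close> whose direction from their
  nearest point in \<open>L\<close> lies in \<open>\<omega>\<close>. By the local Steiner formula its volume is
  \<open>(1/n) (\<Sum>m<n. \<rho>^(n-m) (n choose m) S\<^sub>m(L,\<omega>))\<close>, and \<open>S\<^sub>L(\<omega>)\<close> is the coefficient
  \<open>S\<^sub>m(L,\<omega>)\<close> with \<open>m = n - 1\<close>, that is, the coefficient of \<open>\<rho>\<close>. For bodies with
  interior points it is also the \<open>(n-1)\<close>-dimensional Hausdorff measure of the set of boundary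
  points of \<open>L\<close> having an outer unit normal in \<open>\<omega>\<close>.\<close>

definition local_parallel_set :: "'a::euclidean_space set \<Rightarrow> real \<Rightarrow> 'a set \<Rightarrow> 'a set"
  where "local_parallel_set L \<rho> \<omega> =
    {x. 0 < infdist x L \<and> infdist x L \<le> \<rho> \<and> sgn (x - closest_point L x) \<in> \<omega>}"

definition surface_area_measure :: "'a::euclidean_space set \<Rightarrow> 'a measure"
  where "surface_area_measure L =
    measure_of (sphere 0 1) (sets (restrict_space borel (sphere 0 1)))
      (\<lambda>\<omega>. Lim (at_right 0) (\<lambda>\<rho>. emeasure lebesgue (local_parallel_set L \<rho> \<omega>) / ennreal \<rho>))"

definition mixed_volume :: "'a::euclidean_space set \<Rightarrow> 'a set \<Rightarrow> real"
  where "mixed_volume L K =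
    1 / real DIM('a) * (\<integral>u. support_fun K u \<partial>surface_area_measure L)"

definition mixed_volume_measure :: "'a::euclidean_space set \<Rightarrow> 'a set \<Rightarrow> 'a measure"
  where "mixed_volume_measure L K =
    density (surface_area_measure L) (\<lambda>u. ennreal (1 / real DIM('a) * support_fun K u))"

definition normalized_mixed_volume_measure ::
    "'a::euclidean_space set \<Rightarrow> 'a set \<Rightarrow> 'a measure"
  where "normalized_mixed_volume_measure L K =
    scale_measure (ennreal (1 / mixed_volume L K)) (mixed_volume_measure L K)"

text \<open>Homothety with centre at the origin. Support functions are taken with respect to the
  origin and the integral of \<open>ln (h\<^sub>K / h\<^sub>L)\<close> is not invariant under translating one body only:
  for \<open>L = {-1..1}\<close> and \<open>K = {-1/2..3/2}\<close> on the real line it exceeds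
  \<open>ln (Vol K / Vol L) = 0\<close>.\<close>

definition homothetic :: "'a::euclidean_space set \<Rightarrow> 'a set \<Rightarrow> bool"
  where "homothetic K L \<longleftrightarrow> (\<exists>c>0. K = (\<lambda>x. c *\<^sub>R x) ` L)"

end

theory Submission
  imports Defs
begin

text \<open>With \<open>r\<close> the distance to \<open>L\<close> and \<open>u\<close> the direction from the nearest point, moving outward along
  \<open>u\<close> is expanding, so the volume of \<open>{0 < r \<le> \<rho>, u \<in> \<omega>}\<close> is superadditive in \<open>\<rho>\<close> and its quotient by
  \<open>\<rho>\<close> converges to its infimum. This gives the surface area measure for all Borel \<open>\<omega>\<close> at once, without
  Steiner's formula.

  Since \<open>(L + \<epsilon> K) - L\<close> is contained in \<open>{0 < r \<le> \<epsilon> h\<^sub>K(u)}\<close>, the Brunn-Minkowski inequality yields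
  Minkowski's first inequality. Comparing \<open>{s < r \<le> s + \<epsilon> h\<^sub>L(u)}\<close> with a dilate of the parallel body
  at distance \<open>s\<close> yields \<open>V\<^sub>1(L,L) = Vol L\<close>, and the logarithmic inequality is then
  \<open>ln t \<ge> 1 - 1/t\<close> integrated for \<open>t = h\<^sub>K Vol L / (h\<^sub>L V\<^sub>1)\<close>. Equality forces \<open>h\<^sub>K = \<lambda> h\<^sub>L\<close> almost everywhere;
  Minkowski's inequality for the hull of \<open>K \<union> \<lambda> L\<close> then shows that \<open>K\<close>, \<open>\<lambda> L\<close> and the hull have equal
  volume, so no equality case of Brunn-Minkowski is needed.\<close>

subsection \<open>The surface area measure\<close>

text \<open>The surface area measure is \<open>measure_of\<close> applied to a \<open>Lim\<close>,
  and \<open>measure_of\<close> returns the null measure unless the set function is countably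
  additive, so existence of the limits and countable additivity come before any inequality. Both
  rest on the limit being an infimum. The infimum also makes the lower bound for the volume of a
  collar valid at every thickness and at every distance s from L, not only asymptotically. The
  freedom in s is what V_1(L,L) requires. At a corner of L a collar over L itself can stick out of
  the dilate (1 + \<epsilon>) L to first order in \<epsilon>: for the square with vertices at (1,1)
  and its reflections this happens in directions close to the axes. The parallel body at distance s
  > 0 has no corners. There the excess is of order \<epsilon>^2, with a constant that blows up as s
  tends to 0; hence \<epsilon> goes to 0 first and s afterwards.\<close>

lemma measure_ball_translate:
  fixes x y :: "'a::euclidean_space"
  shows "measure lebesgue (ball x r) = measure lebesgue (ball y r)"
proof -
  have "ball y r = (+) (y - x) ` ball x r"
    by (simp add: image_add_ball)
  then show ?thesis using measure_translation[of "y - x" "ball x r"] by metis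
qed

text \<open>A Vitali cover of S by disjoint balls is moved along with its centres: a contraction
  sends the part of S inside a ball into the ball of equal radius around the image of the centre,
  and the uncovered null set to a null set. Bounding a measurable subset \<open>T\<close> of the
  image sidesteps the question whether the image itself is measurable.\<close>

lemma measure_le_contraction:
  fixes f :: "'a::euclidean_space \<Rightarrow> 'a"
  assumes S: "S \<in> lmeasurable" and T: "T \<in> lmeasurable" and TS: "T \<subseteq> f ` S"
    and lip: "\<And>x y. x \<in> S \<Longrightarrow> y \<in> S \<Longrightarrow> norm (f x - f y) \<le> norm (x - y)"
  shows "measure lebesgue T \<le> measure lebesgue S"
proof (rule field_le_epsilon)
  fix e :: real assume "e > 0"
  obtain U where U: "open U" "S \<subseteq> U" "U - S \<in> lmeasurable" "emeasure lebesgue (U - S) < ennreal e"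
    using sets_lebesgue_outer_open[of S e] S \<open>e > 0\<close> by (auto simp: fmeasurableD)
  have Um: "U \<in> lmeasurable" 
    using fmeasurable.Un[OF S U(3)] U(2) by (simp add: Un_absorb1)
  have mU: "measure lebesgue U \<le> measure lebesgue S + e"
  proof -
    have "measure lebesgue (U - S) < e"
      using U(4) \<open>e > 0\<close> by (simp add: emeasure_eq_measure2[OF U(3)] ennreal_less_iff)
    moreover have "measure lebesgue U \<le> measure lebesgue S + measure lebesgue (U - S)"
      using measure_Un_le[of S lebesgue "U - S"] S U(2,3) by (simp add: Un_absorb1 fmeasurableD)
    ultimately show ?thesis by simp
  qed
  define K where "K = {(x,r). x \<in> S \<and> 0 < r \<and> ball x r \<subseteq> U}"
  have "\<exists>i. i \<in> K \<and> x \<in> ball (fst i) (snd i) \<and> snd i < d" if xd: "x \<in> S" "0 < d" for x d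
  proof -
    obtain k where k: "k > 0" "ball x k \<subseteq> U" using openE[OF U(1) subsetD[OF U(2) xd(1)]] by blast
    show ?thesis
      by (rule exI[of _ "(x, min k (d/2))"]) (use k xd in \<open>auto simp: K_def\<close>)
  qed
  then obtain C where C: "countable C" "C \<subseteq> K"
    "pairwise (\<lambda>i j. disjnt (ball (fst i) (snd i)) (ball (fst j) (snd j))) C"
    "negligible (S - (\<Union>i\<in>C. ball (fst i) (snd i)))"
    by (rule Vitali_covering_theorem_balls)
  define N where "N = S - (\<Union>i\<in>C. ball (fst i) (snd i))"
  have N: "negligible (f ` N)"
  proof (rule negligible_locally_Lipschitz_image)
    show "negligible N" using C(4) by (simp add: N_def)
    fix x assume "x \<in> N"
    then show "\<exists>T B. open T \<and> x \<in> T \<and> (\<forall>y\<in>N \<inter> T. norm (f y - f x) \<le> B * norm (y - x))"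
      by (intro exI[of _ UNIV] exI[of _ 1]) (auto simp: N_def intro: lip)
  qed simp
  define D where "D = (\<lambda>i. ball (f (fst i)) (snd i)) ` C"
  have bound: "measure lebesgue (\<Union>D') \<le> measure lebesgue U" if D': "D' \<subseteq> D" "finite D'" for D'
  proof -
    obtain F where F: "F \<subseteq> C" "finite F" "D' = (\<lambda>i. ball (f (fst i)) (snd i)) ` F"
      using D' unfolding D_def by (meson finite_subset_image)
    \<comment> \<open>The moved balls may overlap, so their union is only bounded by the sum; the
      original balls are disjoint, so the same sum is the volume of a subset of U.\<close>
    have "measure lebesgue (\<Union>D') \<le> (\<Sum>i\<in>F. measure lebesgue (ball (f (fst i)) (snd i)))"
      unfolding F(3) by (rule measure_UNION_le[OF F(2)]) auto
    also have "\<dots> = (\<Sum>i\<in>F. measure lebesgue (ball (fst i) (snd i)))"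
      by (intro sum.cong refl measure_ball_translate)
    also have "\<dots> = measure lebesgue (\<Union>i\<in>F. ball (fst i) (snd i))"
    proof (rule measure_UNION'[symmetric, OF F(2)])
      show "pairwise (\<lambda>i j. disjnt (ball (fst i) (snd i)) (ball (fst j) (snd j))) F"
        using C(3) F(1) by (rule pairwise_subset)
    qed auto
    also have "\<dots> \<le> measure lebesgue U"
    proof (rule measure_mono_fmeasurable[OF _ _ Um])
      show "(\<Union>i\<in>F. ball (fst i) (snd i)) \<subseteq> U"
        using F(1) C(2) unfolding K_def by fastforce
    qed (auto intro!: sets.finite_UN F(2))
    finally show ?thesis .
  qed
  have "countable D" "\<And>A. A \<in> D \<Longrightarrow> A \<in> lmeasurable" using C(1) by (auto simp: D_def)
  then have D: "\<Union>D \<in> lmeasurable" "measure lebesgue (\<Union>D) \<le> measure lebesgue U"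
    using fmeasurable_Union_bound[of D lebesgue, OF _ _ bound] measure_Union_bound[of D lebesgue, OF _ _ bound]
    by blast+
  have "T \<subseteq> \<Union>D \<union> f ` N"
  proof
    fix t assume "t \<in> T"
    then obtain x where x: "x \<in> S" "t = f x" using TS by auto
    show "t \<in> \<Union>D \<union> f ` N"
    proof (cases "x \<in> N")
      case False
      then obtain i where i: "i \<in> C" "x \<in> ball (fst i) (snd i)" using x by (auto simp: N_def)
      then have "fst i \<in> S" using C(2) by (auto simp: K_def)
      then have "t \<in> ball (f (fst i)) (snd i)"
        using lip[of "fst i" x] i x by (auto simp: dist_norm)
      then show ?thesis using i by (auto simp: D_def)
    qed (use x in auto)
  qed
  then have "measure lebesgue T \<le> measure lebesgue (\<Union>D \<union> f ` N)"
    using D N T by (intro measure_mono_fmeasurable fmeasurable.Un) (auto simp: negligible_imp_measurable fmeasurableD)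
  also have "\<dots> \<le> measure lebesgue (\<Union>D) + measure lebesgue (f ` N)"
    using D N by (intro measure_Un_le) (auto simp: negligible_imp_measurable fmeasurableD)
  also have "\<dots> \<le> measure lebesgue U" using D N by (simp add: negligible_imp_measure0)
  finally show "measure lebesgue T \<le> measure lebesgue S + e" using mU by simp
qed

text \<open>At points of \<open>L\<close> the value is \<open>sgn 0 = 0\<close>; a unit vector
  arises only at positive distance.\<close>

definition outer_dir :: "'a::euclidean_space set \<Rightarrow> 'a \<Rightarrow> 'a"
  where "outer_dir L x = sgn (x - closest_point L x)"

text \<open>Strict below and weak above, so that shells with consecutive bounds partition a larger
  one.\<close>

definition shell :: "'a::euclidean_space set \<Rightarrow> real \<Rightarrow> real \<Rightarrow> 'a set \<Rightarrow> 'a set"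
  where "shell L a b \<omega> = {x. a < infdist x L \<and> infdist x L \<le> b \<and> outer_dir L x \<in> \<omega>}"

lemma local_parallel_set_eq_shell: "local_parallel_set L \<rho> \<omega> = shell L 0 \<rho> \<omega>"
  by (simp add: local_parallel_set_def shell_def outer_dir_def)

section \<open>Superadditive functions near the origin\<close>

lemma superadditive_mono:
  fixes g :: "real \<Rightarrow> real"
  assumes nonneg: "\<And>t. 0 \<le> g t"
    and super: "\<And>a b. 0 < a \<Longrightarrow> 0 < b \<Longrightarrow> g a + g b \<le> g (a + b)"
    and "0 < s" "s \<le> t"
  shows "g s \<le> g t"
proof (cases "s = t")
  case False
  then show ?thesis using super[of s "t - s"] nonneg[of "t - s"] assms(3,4) by auto
qed simp

lemma superadditive_mult:
  fixes g :: "real \<Rightarrow> real"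
  assumes super: "\<And>a b. 0 < a \<Longrightarrow> 0 < b \<Longrightarrow> g a + g b \<le> g (a + b)"
    and "0 < t"
  shows "real (Suc n) * g t \<le> g (real (Suc n) * t)"
proof (induction n)
  case (Suc n)
  have "real (Suc (Suc n)) * g t = real (Suc n) * g t + g t" by (simp add: algebra_simps)
  also have "\<dots> \<le> g (real (Suc n) * t) + g t" using Suc by simp
  also have "\<dots> \<le> g (real (Suc n) * t + t)" using assms by (intro super) auto
  also have "real (Suc n) * t + t = real (Suc (Suc n)) * t" by (simp add: algebra_simps)
  finally show ?case .
qed simp

text \<open>Fekete's argument at the origin.\<close>

lemma superadditive_quotient_tendsto:
  fixes g :: "real \<Rightarrow> real"
  assumes nonneg: "\<And>t. 0 \<le> g t"
    and super: "\<And>a b. 0 < a \<Longrightarrow> 0 < b \<Longrightarrow> g a + g b \<le> g (a + b)"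
  shows "((\<lambda>t. g t / t) \<longlongrightarrow> (INF t\<in>{0<..}. g t / t)) (at_right 0)"
proof (rule order_tendstoI)
  let ?l = "INF t\<in>{0<..}. g t / t"
  have bdd: "bdd_below ((\<lambda>t. g t / t) ` {0<..})"
    by (rule bdd_belowI[of _ 0]) (auto intro: divide_nonneg_pos nonneg)
  have le: "?l \<le> g t / t" if "t > 0" for t
    using that by (intro cINF_lower bdd) auto
  show "\<forall>\<^sub>F t in at_right 0. y < g t / t" if "y < ?l" for y
    using eventually_at_right_less[of "0::real"] by eventually_elim (use le that in force)
  fix y assume y: "?l < y"
  then obtain T where T: "T > 0" "g T / T < y"
    using cINF_less_iff[of "{0<..}" "\<lambda>t. g t / t"] bdd by auto
  \<comment> \<open>With n = floor(T/t) one has n g(t) \<le> g(T) and n t > T - t, so the quotient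
    at t is at most g(T)/(T - t), whose limit g(T)/T lies below y.\<close>
  have "((\<lambda>t. g T / (T - t)) \<longlongrightarrow> g T / (T - 0)) (at_right 0)"
    using T by (intro tendsto_intros) auto
  then have ev: "\<forall>\<^sub>F t in at_right 0. g T / (T - t) < y"
    using T by (intro order_tendstoD(2)) auto
  have ev2: "\<forall>\<^sub>F t in at_right 0. t < T"
    using T by (intro order_tendstoD(2)[OF tendsto_ident_at])
  show "\<forall>\<^sub>F t in at_right 0. g t / t < y"
    using ev ev2 eventually_at_right_less[of "0::real"]
  proof eventually_elim
    case (elim t)
    define n where "n = nat \<lfloor>T / t\<rfloor>"
    have n1: "n \<ge> 1" using elim unfolding n_def by (simp add: le_nat_floor)
    have n: "real n \<le> T / t" "T / t < real n + 1" using elim T unfolding n_def by auto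
    have nt: "real n * t \<le> T" "T - t < real n * t" using n elim by (auto simp: field_simps)
    obtain m where m: "n = Suc m" using n1 by (cases n) auto
    have "real n * g t \<le> g (real n * t)"
      unfolding m using superadditive_mult[OF super elim(3)] .
    also have "\<dots> \<le> g T"
      using nt n1 elim by (intro superadditive_mono[OF nonneg super]) auto
    finally have "real n * g t \<le> g T" .
    then have "g t / t \<le> g T / (real n * t)"
      using elim n1 by (simp add: field_simps)
    also have "\<dots> \<le> g T / (T - t)"
      using nt elim by (intro divide_left_mono nonneg) (auto intro!: mult_pos_pos)
    finally show ?case using elim by simp
  qed
qed

section \<open>Nearest points and outer normals of a compact convex set\<close>

locale compact_convex =
  fixes L :: "'a::euclidean_space set"
  assumes compact_L: "compact L" and convex_L: "convex L" and nonempty_L: "L \<noteq> {}"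
begin

lemma closed_L: "closed L"
  using compact_L by (rule compact_imp_closed)

lemma closest_in: "closest_point L x \<in> L"
  using closed_L nonempty_L by (rule closest_point_in_set)

lemma infdist_eq: "infdist x L = norm (x - closest_point L x)"
  using setdist_closest_point[OF closed_L nonempty_L, of x] by (simp add: infdist_eq_setdist dist_norm)

lemma norm_outer_dir: "0 < infdist x L \<Longrightarrow> norm (outer_dir L x) = 1"
  by (simp add: infdist_eq outer_dir_def norm_sgn)

lemma decompose: "x = closest_point L x + infdist x L *\<^sub>R outer_dir L x"
  by (cases "x = closest_point L x") (auto simp: infdist_eq outer_dir_def sgn_div_norm)

lemma inner_outer_dir_le: "y \<in> L \<Longrightarrow> y \<bullet> outer_dir L x \<le> closest_point L x \<bullet> outer_dir L x"
  using closest_point_dot[OF convex_L closed_L, of y x]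
  by (simp add: outer_dir_def sgn_div_norm inner_diff_right inner_diff_left inner_commute
      mult_left_mono divide_right_mono)

text \<open>The direction u is an outer normal of L at the nearest point p, so (p - z) . u \<ge> 0
  for z in L, and the squared distance from p + t u to z is at least t^2 |u|^2.\<close>

lemma closest_point_ray:
  assumes "0 \<le> t"
  shows "closest_point L (closest_point L x + t *\<^sub>R outer_dir L x) = closest_point L x"
proof (rule closest_point_unique[symmetric, OF convex_L closed_L closest_in], rule ballI)
  fix z assume z: "z \<in> L"
  let ?p = "closest_point L x" and ?u = "outer_dir L x"
  have "(z - ?p) \<bullet> ?u \<le> 0" using inner_outer_dir_le[OF z, of x] by (simp add: inner_diff_left)
  then have "0 \<le> t * ((?p - z) \<bullet> ?u)" using assms by (simp add: inner_diff_left)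
  then have "(t *\<^sub>R ?u) \<bullet> (t *\<^sub>R ?u) \<le> (?p + t *\<^sub>R ?u - z) \<bullet> (?p + t *\<^sub>R ?u - z)"
    using inner_ge_zero[of "?p - z"] by (simp add: inner_add inner_diff inner_commute algebra_simps)
  then show "dist (?p + t *\<^sub>R ?u) ?p \<le> dist (?p + t *\<^sub>R ?u) z"
    by (simp only: dist_norm norm_le add_diff_cancel_left')
qed

lemma infdist_ray:
  assumes "0 \<le> t" "0 < infdist x L"
  shows "infdist (closest_point L x + t *\<^sub>R outer_dir L x) L = t"
  using assms by (simp add: infdist_eq[of "_ + _"] closest_point_ray norm_outer_dir)

lemma outer_dir_ray:
  assumes "0 < t" "0 < infdist x L"
  shows "outer_dir L (closest_point L x + t *\<^sub>R outer_dir L x) = outer_dir L x"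
proof -
  have "outer_dir L (closest_point L x + t *\<^sub>R outer_dir L x) = sgn (t *\<^sub>R outer_dir L x)"
    using assms by (simp add: outer_dir_def[of L "_ + _"] closest_point_ray)
  also have "\<dots> = outer_dir L x"
    using assms by (simp add: sgn_scaleR sgn_div_norm norm_outer_dir)
  finally show ?thesis .
qed

lemma outward_shift:
  assumes "0 < infdist x L" "0 \<le> \<delta>"
  shows "infdist (x + \<delta> *\<^sub>R outer_dir L x) L = infdist x L + \<delta>"
    and "outer_dir L (x + \<delta> *\<^sub>R outer_dir L x) = outer_dir L x"
proof -
  have eq: "x + \<delta> *\<^sub>R outer_dir L x = closest_point L x + (infdist x L + \<delta>) *\<^sub>R outer_dir L x"
    by (subst decompose[of x]) (simp add: algebra_simps)
  show "infdist (x + \<delta> *\<^sub>R outer_dir L x) L = infdist x L + \<delta>"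
    unfolding eq using assms by (intro infdist_ray) auto
  show "outer_dir L (x + \<delta> *\<^sub>R outer_dir L x) = outer_dir L x"
    unfolding eq using assms by (intro outer_dir_ray) auto
qed

text \<open>Outer normals are monotone: (p - q) . (u - v) \<ge> 0 for the nearest points p, q. As
  both distances exceed \<delta>, this yields (x - y) . (u - v) \<ge> \<delta> |u - v|^2, and then
  the mixed term outweighs the quadratic one when |x - y - \<delta> (u - v)|^2 is expanded.\<close>

lemma inward_shift_contraction:
  assumes x: "\<delta> < infdist x L" and y: "\<delta> < infdist y L" and d: "0 \<le> \<delta>"
  shows "norm ((x - \<delta> *\<^sub>R outer_dir L x) - (y - \<delta> *\<^sub>R outer_dir L y)) \<le> norm (x - y)"
proof -
  let ?p = "closest_point L x" and ?q = "closest_point L y"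
  let ?u = "outer_dir L x" and ?v = "outer_dir L y"
  let ?r = "infdist x L" and ?s = "infdist y L"
  have u: "?u \<bullet> ?u = 1" "?v \<bullet> ?v = 1"
    using norm_outer_dir[of x] norm_outer_dir[of y] assms by (auto simp: dot_square_norm)
  have uv: "?u \<bullet> ?v \<le> 1"
    using norm_cauchy_schwarz[of ?u ?v] norm_outer_dir[of x] norm_outer_dir[of y] assms by auto
  have 1: "0 \<le> (?p - ?q) \<bullet> (?u - ?v)"
    using inner_outer_dir_le[OF closest_in, of y x] inner_outer_dir_le[OF closest_in, of x y]
    by (simp add: inner_diff)
  have "x - y = (?p - ?q) + (?r *\<^sub>R ?u - ?s *\<^sub>R ?v)"
    by (subst decompose[of x], subst decompose[of y]) simp
  then have "(x - y) \<bullet> (?u - ?v) = (?p - ?q) \<bullet> (?u - ?v) + (?r *\<^sub>R ?u - ?s *\<^sub>R ?v) \<bullet> (?u - ?v)"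
    by (metis inner_add_left)
  also have "(?r *\<^sub>R ?u - ?s *\<^sub>R ?v) \<bullet> (?u - ?v) = (?r + ?s) * (1 - ?u \<bullet> ?v)"
    using u by (simp add: inner_diff inner_commute algebra_simps)
  finally have "(x - y) \<bullet> (?u - ?v) \<ge> (?r + ?s) * (1 - ?u \<bullet> ?v)" using 1 by simp
  moreover have "(?r + ?s) * (1 - ?u \<bullet> ?v) \<ge> (2 * \<delta>) * (1 - ?u \<bullet> ?v)"
    using assms uv by (intro mult_right_mono) auto
  moreover have "\<delta> * ((?u - ?v) \<bullet> (?u - ?v)) = 2 * \<delta> * (1 - ?u \<bullet> ?v)"
    using u by (simp add: inner_diff inner_commute)
  ultimately have 2: "(x - y) \<bullet> (?u - ?v) \<ge> \<delta> * ((?u - ?v) \<bullet> (?u - ?v))" by linarith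
  have 3: "0 \<le> (?u - ?v) \<bullet> (?u - ?v)" by simp
  have "((x - y) - \<delta> *\<^sub>R (?u - ?v)) \<bullet> ((x - y) - \<delta> *\<^sub>R (?u - ?v)) =
      (x - y) \<bullet> (x - y) - 2 * \<delta> * ((x - y) \<bullet> (?u - ?v)) + \<delta> * (\<delta> * ((?u - ?v) \<bullet> (?u - ?v)))"
    by (simp only: inner_diff_left[of "x - y" "\<delta> *\<^sub>R (?u - ?v)"]
        inner_diff_right[of _ "x - y" "\<delta> *\<^sub>R (?u - ?v)"] inner_scaleR_left inner_scaleR_right
        inner_commute[of "?u - ?v" "x - y"]) (simp add: algebra_simps)
  also have "\<dots> \<le> (x - y) \<bullet> (x - y)"
  proof -
    have "\<delta> * (\<delta> * ((?u - ?v) \<bullet> (?u - ?v))) \<le> \<delta> * ((x - y) \<bullet> (?u - ?v))"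
      using 2 d by (rule mult_left_mono)
    moreover have "0 \<le> \<delta> * ((x - y) \<bullet> (?u - ?v))"
      using 2 3 d by (meson mult_nonneg_nonneg order_trans)
    ultimately show ?thesis by linarith
  qed
  finally have "norm ((x - y) - \<delta> *\<^sub>R (?u - ?v)) \<le> norm (x - y)" by (simp add: norm_le)
  moreover have "(x - y) - \<delta> *\<^sub>R (?u - ?v) = (x - \<delta> *\<^sub>R ?u) - (y - \<delta> *\<^sub>R ?v)"
    by (simp add: algebra_simps)
  ultimately show ?thesis by metis
qed

section \<open>Measurability and growth of shells\<close>

lemma measurable_outer_dir [measurable]: "outer_dir L \<in> borel_measurable borel"
proof -
  have [measurable]: "closest_point L \<in> borel_measurable borel"
    by (intro borel_measurable_continuous_onI continuous_on_closest_point convex_L closed_L nonempty_L)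
  show ?thesis unfolding outer_dir_def by measurable
qed

lemma measurable_infdist [measurable]: "(\<lambda>x. infdist x L) \<in> borel_measurable borel"
  by (intro borel_measurable_continuous_onI continuous_intros)

lemma bounded_parallel: "bounded {x. infdist x L \<le> b}"
proof -
  obtain B where B: "\<And>y. y \<in> L \<Longrightarrow> norm y \<le> B"
    using compact_imp_bounded[OF compact_L] by (auto simp: bounded_iff)
  have "norm x \<le> B + b" if "infdist x L \<le> b" for x
    using that B[OF closest_in, of x] norm_triangle_sub[of x "closest_point L x"]
    by (simp add: infdist_eq)
  then show ?thesis by (auto simp: bounded_iff)
qed

lemma lmeasurable_region:
  assumes "{x. P x} \<in> sets borel" "\<And>x. P x \<Longrightarrow> infdist x L \<le> b"
  shows "{x. P x} \<in> lmeasurable"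
  using assms bounded_subset[OF bounded_parallel[of b], of "{x. P x}"]
  by (intro bounded_set_imp_lmeasurable) (auto simp: sets_completionI_sets)

lemma shell_borel:
  assumes "\<omega> \<in> sets borel"
  shows "shell L a b \<omega> \<in> sets borel"
proof -
  have "shell L a b \<omega> = {x. a < infdist x L \<and> infdist x L \<le> b} \<inter> outer_dir L -` \<omega>"
    by (auto simp: shell_def)
  moreover have "{x. a < infdist x L \<and> infdist x L \<le> b} \<in> sets borel" by measurable
  moreover have "outer_dir L -` \<omega> \<in> sets borel"
    using measurable_sets[OF measurable_outer_dir assms] by simp
  ultimately show ?thesis by simp
qed

lemma shell_lmeasurable: "\<omega> \<in> sets borel \<Longrightarrow> shell L a b \<omega> \<in> lmeasurable"
  using shell_borel unfolding shell_def by (rule lmeasurable_region) auto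

text \<open>The expansion is used through its inverse: the inward shift by s is a contraction where
  the distance exceeds s, and it maps the upper shell onto a set containing the lower one.\<close>

lemma measure_shell_shift:
  assumes w: "\<omega> \<in> sets borel" and s: "0 \<le> s"
  shows "measure lebesgue (shell L 0 b \<omega>) \<le> measure lebesgue (shell L s (s + b) \<omega>)"
proof (rule measure_le_contraction[where f = "\<lambda>x. x - s *\<^sub>R outer_dir L x"])
  show "shell L 0 b \<omega> \<subseteq> (\<lambda>x. x - s *\<^sub>R outer_dir L x) ` shell L s (s + b) \<omega>"
  proof
    fix y assume "y \<in> shell L 0 b \<omega>"
    then show "y \<in> (\<lambda>x. x - s *\<^sub>R outer_dir L x) ` shell L s (s + b) \<omega>"
      using outward_shift[of y s] s
      by (intro image_eqI[of _ _ "y + s *\<^sub>R outer_dir L y"]) (auto simp: shell_def)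
  qed
  fix x y assume "x \<in> shell L s (s + b) \<omega>" "y \<in> shell L s (s + b) \<omega>"
  then show "norm ((x - s *\<^sub>R outer_dir L x) - (y - s *\<^sub>R outer_dir L y)) \<le> norm (x - y)"
    using s by (intro inward_shift_contraction) (simp_all add: shell_def)
next
  show "shell L s (s + b) \<omega> \<in> lmeasurable" by (rule shell_lmeasurable[OF w])
next
  show "shell L 0 b \<omega> \<in> lmeasurable" by (rule shell_lmeasurable[OF w])
qed

lemma measure_shell_superadditive:
  assumes w: "\<omega> \<in> sets borel" and "0 < a" "0 < b"
  shows "measure lebesgue (shell L 0 a \<omega>) + measure lebesgue (shell L 0 b \<omega>)
    \<le> measure lebesgue (shell L 0 (a + b) \<omega>)"
proof -
  have "shell L 0 (a + b) \<omega> = shell L 0 a \<omega> \<union> shell L a (a + b) \<omega>"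
    using assms by (auto simp: shell_def)
  moreover have "shell L 0 a \<omega> \<inter> shell L a (a + b) \<omega> = {}" by (auto simp: shell_def)
  ultimately have "measure lebesgue (shell L 0 (a + b) \<omega>) =
      measure lebesgue (shell L 0 a \<omega>) + measure lebesgue (shell L a (a + b) \<omega>)"
    using measure_Un3[OF shell_lmeasurable[OF w] shell_lmeasurable[OF w], of 0 a a "a + b"] by simp
  then show ?thesis using measure_shell_shift[OF w, of a b] assms by simp
qed

section \<open>Area as an infimum and its countable additivity\<close>

definition area :: "'a set \<Rightarrow> real"
  where "area \<omega> = (INF t\<in>{0<..}. measure lebesgue (shell L 0 t \<omega>) / t)"

lemma area_tendsto:
  assumes "\<omega> \<in> sets borel"
  shows "((\<lambda>t. measure lebesgue (shell L 0 t \<omega>) / t) \<longlongrightarrow> area \<omega>) (at_right 0)"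
  unfolding area_def
  by (rule superadditive_quotient_tendsto) (auto intro: measure_shell_superadditive assms)

lemma area_le:
  assumes "\<omega> \<in> sets borel" "0 < t"
  shows "area \<omega> \<le> measure lebesgue (shell L 0 t \<omega>) / t"
  unfolding area_def
  using assms by (intro cINF_lower bdd_belowI[of _ 0]) auto

lemma area_nonneg: "0 \<le> area \<omega>"
  unfolding area_def by (rule cINF_greatest) auto

lemma sets_sphereD:
  fixes \<omega> :: "'a set"
  shows "\<omega> \<in> sets (restrict_space borel (sphere 0 1)) \<Longrightarrow> \<omega> \<in> sets borel"
  by (auto simp: sets_restrict_space)

lemma parallel_quotient_tendsto:
  assumes w: "\<omega> \<in> sets borel"
  shows "((\<lambda>\<rho>. emeasure lebesgue (local_parallel_set L \<rho> \<omega>) / ennreal \<rho>) \<longlongrightarrow> ennreal (area \<omega>)) (at_right 0)"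
proof (rule Lim_transform_eventually[OF tendsto_ennrealI[OF area_tendsto[OF w]]])
  show "\<forall>\<^sub>F t in at_right 0. ennreal (measure lebesgue (shell L 0 t \<omega>) / t) =
      emeasure lebesgue (local_parallel_set L t \<omega>) / ennreal t"
    using eventually_at_right_less[of "0::real"]
    by eventually_elim
      (simp add: local_parallel_set_eq_shell emeasure_eq_measure2[OF shell_lmeasurable[OF w]] divide_ennreal)
qed

lemma area_additive:
  assumes "A \<in> sets borel" "B \<in> sets borel" "A \<inter> B = {}"
  shows "area (A \<union> B) = area A + area B"
proof (rule tendsto_unique[OF trivial_limit_at_right_real area_tendsto])
  have "shell L 0 t (A \<union> B) = shell L 0 t A \<union> shell L 0 t B" for t
    by (auto simp: shell_def)
  moreover have "shell L 0 t A \<inter> shell L 0 t B = {}" for t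
    using assms(3) by (auto simp: shell_def)
  ultimately have "measure lebesgue (shell L 0 t (A \<union> B)) =
      measure lebesgue (shell L 0 t A) + measure lebesgue (shell L 0 t B)" for t
    using measure_Un3[OF shell_lmeasurable[OF assms(1)] shell_lmeasurable[OF assms(2)], of 0 t 0 t] by simp
  then show "((\<lambda>t. measure lebesgue (shell L 0 t (A \<union> B)) / t) \<longlongrightarrow> area A + area B) (at_right 0)"
    using tendsto_add[OF area_tendsto[OF assms(1)] area_tendsto[OF assms(2)]]
    by (simp add: add_divide_distrib)
qed (use assms in auto)

text \<open>As an infimum, \<open>area\<close> is dominated by the volume of the shell of thickness
  1, so continuity is inherited from Lebesgue measure and no limits have to be interchanged.\<close>

lemma area_continuous_at_empty:
  assumes A: "\<And>i. A i \<in> sets borel" "decseq A" "(\<Inter>i. A i) = {}"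
  shows "(\<lambda>i. area (A i)) \<longlonglongrightarrow> 0"
proof -
  have "(\<lambda>i. measure lebesgue (shell L 0 1 (A i))) \<longlonglongrightarrow> measure lebesgue (\<Inter>i. shell L 0 1 (A i))"
  proof (rule Lim_measure_decseq)
    show "decseq (\<lambda>i. shell L 0 1 (A i))"
      using A(2) by (force simp: decseq_def shell_def)
    show "range (\<lambda>i. shell L 0 1 (A i)) \<subseteq> sets lebesgue"
      using shell_lmeasurable[OF A(1), of 0 1] by (auto intro: fmeasurableD)
    show "emeasure lebesgue (shell L 0 1 (A i)) \<noteq> \<infinity>" for i
      using fmeasurableD2[OF shell_lmeasurable[OF A(1), of 0 1]] by (simp only: infinity_ennreal_def not_False_eq_True)
  qed
  moreover have "(\<Inter>i. shell L 0 1 (A i)) = {}" using A(3) by (auto simp: shell_def)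
  ultimately have "(\<lambda>i. measure lebesgue (shell L 0 1 (A i))) \<longlonglongrightarrow> 0" by simp
  then show ?thesis
    by (rule tendsto_sandwich[OF _ _ tendsto_const, rotated 2])
      (use area_nonneg area_le[OF A(1), of 1] in auto)
qed

lemma sets_surface [simp, measurable_cong]:
    "sets (surface_area_measure L) = sets (restrict_space borel (sphere 0 1))"
  and space_surface [simp]: "space (surface_area_measure L) = sphere 0 1"
proof -
  have "sets (restrict_space borel (sphere 0 1)) \<subseteq> Pow (sphere 0 1 :: 'a set)"
    using sets.space_closed[of "restrict_space borel (sphere 0 1 :: 'a set)"] by (simp add: space_restrict_space)
  moreover have "sigma_sets (sphere 0 1) (sets (restrict_space borel (sphere 0 1))) =
      sets (restrict_space borel (sphere 0 1 :: 'a set))"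
    using sets.sigma_sets_eq[of "restrict_space borel (sphere 0 1 :: 'a set)"] by (simp add: space_restrict_space)
  ultimately show "sets (surface_area_measure L) = sets (restrict_space borel (sphere 0 1))"
    "space (surface_area_measure L) = sphere 0 1"
    by (auto simp: surface_area_measure_def space_measure_of_conv)
qed

lemma emeasure_surface:
  assumes "\<omega> \<in> sets (restrict_space borel (sphere 0 1))"
  shows "emeasure (surface_area_measure L) \<omega> = ennreal (area \<omega>)"
proof -
  let ?M = "sets (restrict_space borel (sphere 0 1 :: 'a set))"
  let ?\<mu> = "\<lambda>\<omega>. Lim (at_right 0) (\<lambda>\<rho>. emeasure lebesgue (local_parallel_set L \<rho> \<omega>) / ennreal \<rho>)"
  have lim: "?\<mu> \<omega> = ennreal (area \<omega>)" if "\<omega> \<in> ?M" for \<omega>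
    using that by (intro tendsto_Lim parallel_quotient_tendsto sets_sphereD) auto
  have sp: "?M \<subseteq> Pow (sphere 0 1)"
    using sets.space_closed[of "restrict_space borel (sphere 0 1 :: 'a set)"] by (simp add: space_restrict_space)
  have alg: "sigma_algebra (sphere 0 1) ?M"
    using sets.sigma_algebra_axioms[of "restrict_space borel (sphere 0 1 :: 'a set)"] by (simp add: space_restrict_space)
  then interpret M: sigma_algebra "sphere 0 1" ?M .
  have empty: "area {} = 0" 
    using area_le[of "{}" 1] area_nonneg[of "{}"] by (simp add: shell_def)
  have pos: "positive ?M ?\<mu>"
    using lim[of "{}"] by (simp add: positive_def empty)
  have "countably_additive ?M ?\<mu>"
  proof (rule M.empty_continuous_imp_countably_additive[OF pos])
    show "additive ?M ?\<mu>"
      unfolding additive_def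
    proof (intro ballI impI)
      fix A B assume AB: "A \<in> ?M" "B \<in> ?M" "A \<inter> B = {}"
      then have "A \<union> B \<in> ?M" by auto
      with AB show "?\<mu> (A \<union> B) = ?\<mu> A + ?\<mu> B"
        by (simp only: lim area_additive[OF sets_sphereD sets_sphereD] ennreal_plus area_nonneg)
    qed
    show "\<forall>A\<in>?M. ?\<mu> A \<noteq> \<infinity>" by (simp add: lim)
    fix A :: "nat \<Rightarrow> 'a set" assume A: "range A \<subseteq> ?M" "decseq A" "\<Inter> (range A) = {}"
    then have "(\<lambda>i. ennreal (area (A i))) \<longlonglongrightarrow> ennreal 0"
      by (intro tendsto_ennrealI area_continuous_at_empty) (auto intro: sets_sphereD)
    moreover have "?\<mu> (A i) = ennreal (area (A i))" for i using A by (intro lim) auto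
    ultimately show "(\<lambda>i. ?\<mu> (A i)) \<longlonglongrightarrow> 0" by simp
  qed
  with pos have "emeasure (surface_area_measure L) \<omega> = ?\<mu> \<omega>"
    using assms alg by (intro emeasure_measure_of[OF surface_area_measure_def sp]) auto
  then show ?thesis using lim[OF assms] by simp
qed

lemma sphere_sets_surface: "sphere 0 1 \<in> sets (restrict_space borel (sphere 0 1 :: 'a set))"
  using sets.top[of "restrict_space borel (sphere 0 1 :: 'a set)"] by (simp add: space_restrict_space)

lemma finite_measure_surface: "finite_measure (surface_area_measure L)"
proof (rule finite_measureI)
  show "emeasure (surface_area_measure L) (space (surface_area_measure L)) \<noteq> \<infinity>"
    unfolding space_surface emeasure_surface[OF sphere_sets_surface] by simp
qed

lemma measure_surface:
  assumes "\<omega> \<in> sets (restrict_space borel (sphere 0 1))"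
  shows "measure (surface_area_measure L) \<omega> = area \<omega>"
  by (simp add: measure_def emeasure_surface[OF assms] area_nonneg)

end

subsection \<open>Integrals against the surface area measure\<close>

context compact_convex
begin

text \<open>For \<open>s = 0\<close> and \<open>h\<close> the support function of K, adjoining L
  gives a set that contains L + \<epsilon> K. For s > 0 the thickness is measured from the parallel
  body at distance s, while directions still refer to L.\<close>

definition collar :: "('a \<Rightarrow> real) \<Rightarrow> real \<Rightarrow> real \<Rightarrow> 'a set"
  where "collar h s \<epsilon> = {x. s < infdist x L \<and> infdist x L \<le> s + \<epsilon> * h (outer_dir L x)}"

text \<open>For \<delta> > 0 the bands are disjoint, and a point with h u \<le> 0 lies in none of
  them, which matches the collar being empty in such a direction.\<close>

definition level_band :: "('a \<Rightarrow> real) \<Rightarrow> real \<Rightarrow> nat \<Rightarrow> 'a set"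
  where "level_band h \<delta> j = {u \<in> sphere 0 1. real j * \<delta> < h u \<and> h u \<le> (real j + 1) * \<delta>}"

lemma collar_lmeasurable:
  assumes h: "h \<in> borel_measurable borel" and R: "\<And>u. u \<in> sphere 0 1 \<Longrightarrow> h u \<le> R"
    and "0 \<le> s" "0 \<le> \<epsilon>"
  shows "collar h s \<epsilon> \<in> lmeasurable"
  unfolding collar_def
proof (rule lmeasurable_region)
  have [measurable]: "(\<lambda>x. h (outer_dir L x)) \<in> borel_measurable borel"
    using measurable_compose[OF measurable_outer_dir h] .
  show "{x. s < infdist x L \<and> infdist x L \<le> s + \<epsilon> * h (outer_dir L x)} \<in> sets borel"
    by measurable
  fix x assume x: "s < infdist x L \<and> infdist x L \<le> s + \<epsilon> * h (outer_dir L x)"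
  then have "h (outer_dir L x) \<le> R" using assms norm_outer_dir[of x] by (intro R) auto
  then have "\<epsilon> * h (outer_dir L x) \<le> \<epsilon> * R" using assms(4) by (rule mult_left_mono)
  with x show "infdist x L \<le> s + \<epsilon> * R" by linarith
qed

lemma level_band_borel: "h \<in> borel_measurable borel \<Longrightarrow> level_band h \<delta> j \<in> sets borel"
proof -
  assume [measurable]: "h \<in> borel_measurable borel"
  have [measurable]: "sphere 0 1 \<in> sets (borel :: 'a measure)" by (intro borel_closed closed_sphere)
  have "level_band h \<delta> j = sphere 0 1 \<inter> {u. real j * \<delta> < h u \<and> h u \<le> (real j + 1) * \<delta>}"
    by (auto simp: level_band_def)
  then show ?thesis by simp
qed

lemma level_band_sets:
  "h \<in> borel_measurable borel \<Longrightarrow> level_band h \<delta> j \<in> sets (restrict_space borel (sphere 0 1))"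
  using level_band_borel[of h \<delta> j] borel_closed[OF closed_sphere, of "0::'a" 1]
  by (subst sets_restrict_space_iff) (auto simp: level_band_def)

lemma level_band_unique:
  assumes "u \<in> level_band h \<delta> i" "u \<in> level_band h \<delta> j" "0 < \<delta>"
  shows "i = j"
proof -
  have "real i * \<delta> < h u" "h u \<le> (real i + 1) * \<delta>" "real j * \<delta> < h u" "h u \<le> (real j + 1) * \<delta>"
    using assms(1,2) by (simp_all add: level_band_def)
  then have "real i * \<delta> < (real j + 1) * \<delta>" "real j * \<delta> < (real i + 1) * \<delta>"
    by linarith+
  then have "real i < real j + 1" "real j < real i + 1"
    using mult_less_cancel_right_pos[OF assms(3)] by blast+
  then show ?thesis by linarith
qed

lemma level_band_exists:
  assumes "u \<in> sphere 0 1" "0 < h u" "h u \<le> R" "R \<le> real N * \<delta>" "0 < \<delta>"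
  obtains j where "j < N" "u \<in> level_band h \<delta> j"
proof -
  \<comment> \<open>The bands contain their upper ends, so the index is the ceiling of h u /
    \<delta> minus one.\<close>
  define k where "k = nat (\<lceil>h u / \<delta>\<rceil>)"
  have pos: "0 < h u / \<delta>" using assms by simp
  then have k: "real k - 1 < h u / \<delta>" "h u / \<delta> \<le> real k" unfolding k_def by linarith+
  with pos obtain j where j: "k = Suc j" by (cases k) auto
  have j': "real j * \<delta> < h u" "h u \<le> (real j + 1) * \<delta>"
    using k assms(5) unfolding j by (auto simp: field_simps)
  have "real j * \<delta> < real N * \<delta>" using j' assms by linarith
  then have "j < N" using assms(5) by simp
  with j' assms(1) that show thesis by (auto simp: level_band_def)
qed

lemma sum_level_band:
  assumes "u \<in> level_band h \<delta> j" "j < N" "0 < \<delta>"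
  shows "(\<Sum>i<N. c i * indicator (level_band h \<delta> i) u) = (c j :: real)"
proof -
  have "(\<Sum>i<N. c i * indicator (level_band h \<delta> i) u) = (\<Sum>i<N. if i = j then c i else 0)"
    using assms(1,3) by (intro sum.cong) (auto simp: indicator_def dest: level_band_unique)
  then show ?thesis using assms by simp
qed

lemma measurable_surface:
  "h \<in> borel_measurable borel \<Longrightarrow> h \<in> borel_measurable (surface_area_measure L)"
  by (simp add: measurable_cong_sets[OF sets_surface refl] measurable_restrict_space1)

lemma integrable_surface:
  fixes h :: "'a \<Rightarrow> real"
  assumes "h \<in> borel_measurable borel" "\<And>u. u \<in> sphere 0 1 \<Longrightarrow> \<bar>h u\<bar> \<le> R"
  shows "integrable (surface_area_measure L) h"
proof -
  interpret finite_measure "surface_area_measure L" by (rule finite_measure_surface)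
  show ?thesis
    using assms by (intro integrable_const_bound[where B = R] measurable_surface AE_I2) auto
qed

lemma integral_level_bands:
  assumes h: "h \<in> borel_measurable borel"
  shows "integrable (surface_area_measure L) (\<lambda>u. \<Sum>i<N. c i * indicator (level_band h \<delta> i) u :: real)"
    and "(\<integral>u. (\<Sum>i<N. c i * indicator (level_band h \<delta> i) u) \<partial>surface_area_measure L)
      = (\<Sum>i<N. c i * area (level_band h \<delta> i))"
proof -
  interpret finite_measure "surface_area_measure L" by (rule finite_measure_surface)
  have sets: "level_band h \<delta> i \<in> sets (surface_area_measure L)" for i
    using level_band_sets[OF h] by simp
  have int: "integrable (surface_area_measure L) (\<lambda>u. c i * indicator (level_band h \<delta> i) u)" for i
    by (intro integrable_mult_right integrable_real_indicator sets) (simp add: emeasure_finite less_top[symmetric])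
  show "integrable (surface_area_measure L) (\<lambda>u. \<Sum>i<N. c i * indicator (level_band h \<delta> i) u)"
    by (intro Bochner_Integration.integrable_sum int)
  have "level_band h \<delta> i \<inter> sphere 0 1 = level_band h \<delta> i" for i by (auto simp: level_band_def)
  then show "(\<integral>u. (\<Sum>i<N. c i * indicator (level_band h \<delta> i) u) \<partial>surface_area_measure L)
      = (\<Sum>i<N. c i * area (level_band h \<delta> i))"
    by (subst Bochner_Integration.integral_sum[OF int])
      (simp add: measure_surface[OF level_band_sets[OF h]])
qed

text \<open>The step functions with the upper and the lower end values of the bands differ from h by
  at most \<delta>, also where h vanishes and both are 0; \<open>area (sphere 0 1)\<close> is the
  total mass.\<close>

lemma integral_level_bounds:
  assumes h: "h \<in> borel_measurable borel" and R: "\<And>u. u \<in> sphere 0 1 \<Longrightarrow> 0 \<le> h u \<and> h u \<le> R"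
    and d: "0 < \<delta>" and N: "R \<le> real N * \<delta>"
  shows "(\<Sum>i<N. ((real i + 1) * \<delta>) * area (level_band h \<delta> i))
      \<le> (\<integral>u. h u \<partial>surface_area_measure L) + \<delta> * area (sphere 0 1)"
    and "(\<integral>u. h u \<partial>surface_area_measure L)
      \<le> (\<Sum>i<N. (real i * \<delta>) * area (level_band h \<delta> i)) + \<delta> * area (sphere 0 1)"
proof -
  interpret finite_measure "surface_area_measure L" by (rule finite_measure_surface)
  let ?M = "surface_area_measure L"
  have int: "integrable ?M h" using R by (intro integrable_surface[OF h, of R]) auto
  have const: "(\<integral>u. \<delta> \<partial>?M) = \<delta> * area (sphere 0 1)"
    using measure_surface[OF sphere_sets_surface] by simp
  have "(\<Sum>i<N. ((real i + 1) * \<delta>) * area (level_band h \<delta> i))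
      = (\<integral>u. (\<Sum>i<N. ((real i + 1) * \<delta>) * indicator (level_band h \<delta> i) u) \<partial>?M)"
    by (simp only: integral_level_bands[OF h])
  also have "\<dots> \<le> (\<integral>u. h u + \<delta> \<partial>?M)"
  proof (rule integral_mono[OF integral_level_bands(1)[OF h] Bochner_Integration.integrable_add[OF int integrable_const]])
    fix u assume "u \<in> space ?M"
    then have u: "u \<in> sphere 0 1" by simp
    show "(\<Sum>i<N. ((real i + 1) * \<delta>) * indicator (level_band h \<delta> i) u) \<le> h u + \<delta>"
    proof (cases "0 < h u")
      case True
      then obtain j where j: "j < N" "u \<in> level_band h \<delta> j"
        using level_band_exists[OF u, of h R N \<delta>] R[OF u] N d by auto
      then have "(\<Sum>i<N. ((real i + 1) * \<delta>) * indicator (level_band h \<delta> i) u) = (real j + 1) * \<delta>"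
        using d by (intro sum_level_band)
      then show ?thesis using j(2) by (simp add: level_band_def algebra_simps)
    next
      case False
      have "u \<notin> level_band h \<delta> i" for i
      proof
        assume "u \<in> level_band h \<delta> i"
        then have "real i * \<delta> < h u" by (simp add: level_band_def)
        moreover have "0 \<le> real i * \<delta>" using d by simp
        ultimately show False using False by linarith
      qed
      then have "(\<Sum>i<N. ((real i + 1) * \<delta>) * indicator (level_band h \<delta> i) u) = 0" by simp
      then show ?thesis using R[OF u] d by linarith
    qed
  qed
  also have "\<dots> = (\<integral>u. h u \<partial>?M) + \<delta> * area (sphere 0 1)"
    by (simp only: const Bochner_Integration.integral_add[OF int integrable_const])
  finally show "(\<Sum>i<N. ((real i + 1) * \<delta>) * area (level_band h \<delta> i))
      \<le> (\<integral>u. h u \<partial>?M) + \<delta> * area (sphere 0 1)" .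
  have "(\<integral>u. h u \<partial>?M) \<le> (\<integral>u. (\<Sum>i<N. (real i * \<delta>) * indicator (level_band h \<delta> i) u) + \<delta> \<partial>?M)"
  proof (rule integral_mono[OF int Bochner_Integration.integrable_add[OF integral_level_bands(1)[OF h] integrable_const]])
    fix u assume "u \<in> space ?M"
    then have u: "u \<in> sphere 0 1" by simp
    show "h u \<le> (\<Sum>i<N. (real i * \<delta>) * indicator (level_band h \<delta> i) u) + \<delta>"
    proof (cases "0 < h u")
      case True
      then obtain j where j: "j < N" "u \<in> level_band h \<delta> j"
        using level_band_exists[OF u, of h R N \<delta>] R[OF u] N d by auto
      then have "(\<Sum>i<N. (real i * \<delta>) * indicator (level_band h \<delta> i) u) = real j * \<delta>"
        using d by (intro sum_level_band)
      then show ?thesis using j(2) by (simp add: level_band_def algebra_simps)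
    next
      case False
      have "0 \<le> (\<Sum>i<N. (real i * \<delta>) * indicator (level_band h \<delta> i) u)"
        using d by (intro sum_nonneg) auto
      then show ?thesis using d False by linarith
    qed
  qed
  also have "\<dots> = (\<Sum>i<N. (real i * \<delta>) * area (level_band h \<delta> i)) + \<delta> * area (sphere 0 1)"
    by (simp only: const Bochner_Integration.integral_add[OF integral_level_bands(1)[OF h] integrable_const]
      integral_level_bands(2)[OF h])
  finally show "(\<integral>u. h u \<partial>?M)
      \<le> (\<Sum>i<N. (real i * \<delta>) * area (level_band h \<delta> i)) + \<delta> * area (sphere 0 1)" .
qed

section \<open>Integrals compared with volumes of collars\<close>

lemma area_tendsto_scaled:
  assumes w: "\<omega> \<in> sets borel" and "0 < k"
  shows "((\<lambda>t. measure lebesgue (shell L 0 (t * k) \<omega>) / t) \<longlongrightarrow> k * area \<omega>) (at_right 0)"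
proof -
  have "filterlim (\<lambda>t. t * k) (at_right 0) (at_right 0)"
    unfolding filterlim_at
  proof
    show "((\<lambda>t. t * k) \<longlongrightarrow> 0) (at_right 0)" by (rule tendsto_eq_intros refl | simp)+
    show "\<forall>\<^sub>F t in at_right 0. t * k \<in> {0<..} \<and> t * k \<noteq> 0"
      using eventually_at_right_less[of "0::real"] by eventually_elim (use \<open>0 < k\<close> in auto)
  qed
  then have "((\<lambda>t. k * (measure lebesgue (shell L 0 (t * k) \<omega>) / (t * k))) \<longlongrightarrow> k * area \<omega>) (at_right 0)"
    by (intro tendsto_mult tendsto_const filterlim_compose[OF area_tendsto[OF w]])
  then show ?thesis using \<open>0 < k\<close> by simp
qed

text \<open>For fixed \<delta> the collar is covered by finitely many shells of constant thickness,
  one for each band with the upper value of h there. The limit \<epsilon> to 0 can therefore be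
  taken term by term, and the discretisation costs at most
  \<open>\<delta> * area (sphere 0 1)\<close>.\<close>

lemma integral_ge_of_collar:
  assumes h: "h \<in> borel_measurable borel" and R: "\<And>u. u \<in> sphere 0 1 \<Longrightarrow> 0 \<le> h u \<and> h u \<le> R"
    and c: "\<And>\<epsilon>. 0 < \<epsilon> \<Longrightarrow> c * \<epsilon> \<le> measure lebesgue (collar h 0 \<epsilon>)"
  shows "c \<le> (\<integral>u. h u \<partial>surface_area_measure L)"
proof (rule field_le_epsilon)
  fix e :: real assume "e > 0"
  \<comment> \<open>The summand 1 keeps the denominator positive if the total area is 0.\<close>
  define \<delta> where "\<delta> = e / (area (sphere 0 1) + 1)"
  have d: "\<delta> > 0" "\<delta> * area (sphere 0 1) \<le> e"
    using \<open>e > 0\<close> area_nonneg[of "sphere 0 1"] by (auto simp: \<delta>_def field_simps)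
  obtain N where N: "R \<le> real N * \<delta>"
    using reals_Archimedean3[OF d(1)] by (meson less_imp_le)
  let ?\<omega> = "level_band h \<delta>"
  have le: "c \<le> (\<Sum>i<N. measure lebesgue (shell L 0 (\<epsilon> * ((real i + 1) * \<delta>)) (?\<omega> i)) / \<epsilon>)" if "0 < \<epsilon>" for \<epsilon>
  proof -
    have "collar h 0 \<epsilon> \<subseteq> (\<Union>i<N. shell L 0 (\<epsilon> * ((real i + 1) * \<delta>)) (?\<omega> i))"
    proof
      fix x assume "x \<in> collar h 0 \<epsilon>"
      then have x: "0 < infdist x L" "infdist x L \<le> \<epsilon> * h (outer_dir L x)" by (auto simp: collar_def)
      then have u: "outer_dir L x \<in> sphere 0 1" using norm_outer_dir by simp
      have "0 < \<epsilon> * h (outer_dir L x)" using x by linarith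
      then have "0 < h (outer_dir L x)" using that by (simp add: zero_less_mult_iff)
      then obtain j where j: "j < N" "outer_dir L x \<in> ?\<omega> j"
        using level_band_exists[OF u _ _ N d(1)] R[OF u] by blast
      then have "\<epsilon> * h (outer_dir L x) \<le> \<epsilon> * ((real j + 1) * \<delta>)"
        using that by (intro mult_left_mono) (auto simp: level_band_def)
      then show "x \<in> (\<Union>i<N. shell L 0 (\<epsilon> * ((real i + 1) * \<delta>)) (?\<omega> i))"
        using x j by (force simp: shell_def)
    qed
    then have "measure lebesgue (collar h 0 \<epsilon>) \<le> measure lebesgue (\<Union>i<N. shell L 0 (\<epsilon> * ((real i + 1) * \<delta>)) (?\<omega> i))"
      using that R by (intro measure_mono_fmeasurable fmeasurableD[OF collar_lmeasurable[OF h, of R]]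
          fmeasurable.finite_UN shell_lmeasurable level_band_borel h) auto
    also have "\<dots> \<le> (\<Sum>i<N. measure lebesgue (shell L 0 (\<epsilon> * ((real i + 1) * \<delta>)) (?\<omega> i)))"
      by (intro measure_UNION_le fmeasurableD shell_lmeasurable level_band_borel h) auto
    finally have "c * \<epsilon> \<le> (\<Sum>i<N. measure lebesgue (shell L 0 (\<epsilon> * ((real i + 1) * \<delta>)) (?\<omega> i)))"
      using c[OF that] by linarith
    then show ?thesis using that by (simp add: sum_divide_distrib[symmetric] field_simps)
  qed
  have lim: "((\<lambda>\<epsilon>. \<Sum>i<N. measure lebesgue (shell L 0 (\<epsilon> * ((real i + 1) * \<delta>)) (?\<omega> i)) / \<epsilon>)
      \<longlongrightarrow> (\<Sum>i<N. ((real i + 1) * \<delta>) * area (?\<omega> i))) (at_right 0)"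
    using d by (intro tendsto_sum area_tendsto_scaled level_band_borel h) auto
  have "\<forall>\<^sub>F \<epsilon> in at_right 0. c \<le> (\<Sum>i<N. measure lebesgue (shell L 0 (\<epsilon> * ((real i + 1) * \<delta>)) (?\<omega> i)) / \<epsilon>)"
    using eventually_at_right_less[of "0::real"] by (rule eventually_mono) (rule le)
  then have "c \<le> (\<Sum>i<N. ((real i + 1) * \<delta>) * area (?\<omega> i))"
    by (rule tendsto_lowerbound[OF lim]) simp
  also have "\<dots> \<le> (\<integral>u. h u \<partial>surface_area_measure L) + \<delta> * area (sphere 0 1)"
    by (rule integral_level_bounds(1)[OF h R d(1) N])
  finally show "c \<le> (\<integral>u. h u \<partial>surface_area_measure L) + e" using d(2) by linarith
qed

text \<open>Here the shells use the lower values of h, so they are disjoint and fit inside the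
  collar. Each has at least thickness times area as its volume, because area is an infimum over all
  thicknesses and shells do not shrink when moved out to distance s. Hence the bound holds for each
  single \<epsilon> and s.\<close>

lemma integral_le_collar:
  assumes h: "h \<in> borel_measurable borel" and R: "\<And>u. u \<in> sphere 0 1 \<Longrightarrow> 0 \<le> h u \<and> h u \<le> R"
    and s: "0 \<le> s" and \<epsilon>: "0 < \<epsilon>"
  shows "\<epsilon> * (\<integral>u. h u \<partial>surface_area_measure L) \<le> measure lebesgue (collar h s \<epsilon>)"
proof (rule field_le_epsilon)
  fix e :: real assume "e > 0"
  define \<delta> where "\<delta> = e / (\<epsilon> * (area (sphere 0 1) + 1))"
  have d: "\<delta> > 0" "\<epsilon> * (\<delta> * area (sphere 0 1)) \<le> e"
    using \<open>e > 0\<close> \<epsilon> area_nonneg[of "sphere 0 1"] by (auto simp: \<delta>_def field_simps add_pos_nonneg)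
  obtain N where N: "R \<le> real N * \<delta>"
    using reals_Archimedean3[OF d(1)] by (meson less_imp_le)
  let ?\<omega> = "level_band h \<delta>"
  have "\<epsilon> * (\<integral>u. h u \<partial>surface_area_measure L)
      \<le> \<epsilon> * ((\<Sum>i<N. (real i * \<delta>) * area (?\<omega> i)) + \<delta> * area (sphere 0 1))"
    using \<epsilon> by (intro mult_left_mono integral_level_bounds(2)[OF h R d(1) N]) auto
  also have "\<dots> \<le> (\<Sum>i<N. \<epsilon> * (real i * \<delta>) * area (?\<omega> i)) + e"
    using d(2) by (simp add: distrib_left sum_distrib_left mult.assoc)
  also have "(\<Sum>i<N. \<epsilon> * (real i * \<delta>) * area (?\<omega> i))
      \<le> (\<Sum>i<N. measure lebesgue (shell L s (s + \<epsilon> * (real i * \<delta>)) (?\<omega> i)))"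
  proof (rule sum_mono)
    fix i assume "i \<in> {..<N}"
    \<comment> \<open>The lowest band gets thickness 0, where the infimum says nothing; its term
      vanishes.\<close>
    show "\<epsilon> * (real i * \<delta>) * area (?\<omega> i) \<le> measure lebesgue (shell L s (s + \<epsilon> * (real i * \<delta>)) (?\<omega> i))"
    proof (cases "i = 0")
      case False
      then have pos: "0 < \<epsilon> * (real i * \<delta>)" using d \<epsilon> by simp
      have "\<epsilon> * (real i * \<delta>) * area (?\<omega> i) \<le> measure lebesgue (shell L 0 (\<epsilon> * (real i * \<delta>)) (?\<omega> i))"
        using area_le[OF level_band_borel[OF h] pos, of \<delta> i] pos by (simp add: field_simps)
      also have "\<dots> \<le> measure lebesgue (shell L s (s + \<epsilon> * (real i * \<delta>)) (?\<omega> i))"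
        by (rule measure_shell_shift[OF level_band_borel[OF h] s])
      finally show ?thesis .
    qed simp
  qed
  also have "(\<Sum>i<N. measure lebesgue (shell L s (s + \<epsilon> * (real i * \<delta>)) (?\<omega> i)))
      = measure lebesgue (\<Union>i<N. shell L s (s + \<epsilon> * (real i * \<delta>)) (?\<omega> i))"
  proof (rule measure_UNION'[symmetric])
    show "pairwise (\<lambda>i j. disjnt (shell L s (s + \<epsilon> * (real i * \<delta>)) (?\<omega> i)) (shell L s (s + \<epsilon> * (real j * \<delta>)) (?\<omega> j))) {..<N}"
      using level_band_unique[OF _ _ d(1)] by (auto simp: pairwise_def disjnt_def shell_def)
  qed (auto intro: shell_lmeasurable level_band_borel h)
  also have "\<dots> \<le> measure lebesgue (collar h s \<epsilon>)"
  proof (rule measure_mono_fmeasurable)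
    show "collar h s \<epsilon> \<in> lmeasurable"
      using R s \<epsilon> by (intro collar_lmeasurable[OF h, of R]) auto
    show "(\<Union>i<N. shell L s (s + \<epsilon> * (real i * \<delta>)) (?\<omega> i)) \<in> sets lebesgue"
      by (intro sets.finite_UN fmeasurableD shell_lmeasurable level_band_borel h) auto
    show "(\<Union>i<N. shell L s (s + \<epsilon> * (real i * \<delta>)) (?\<omega> i)) \<subseteq> collar h s \<epsilon>"
    proof
      fix x assume "x \<in> (\<Union>i<N. shell L s (s + \<epsilon> * (real i * \<delta>)) (?\<omega> i))"
      then obtain i where i: "s < infdist x L" "infdist x L \<le> s + \<epsilon> * (real i * \<delta>)" "outer_dir L x \<in> ?\<omega> i"
        by (auto simp: shell_def)
      have "\<epsilon> * (real i * \<delta>) \<le> \<epsilon> * h (outer_dir L x)"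
        using i(3) \<epsilon> by (intro mult_left_mono) (auto simp: level_band_def)
      with i show "x \<in> collar h s \<epsilon>" by (simp add: collar_def)
    qed
  qed
  finally show "\<epsilon> * (\<integral>u. h u \<partial>surface_area_measure L) \<le> measure lebesgue (collar h s \<epsilon>) + e" by simp
qed

end

subsection \<open>The Brunn-Minkowski inequality\<close>

definition minkowski_sum :: "'a::euclidean_space set \<Rightarrow> 'a set \<Rightarrow> 'a set"
  where "minkowski_sum A B = (\<Union>x\<in>A. \<Union>y\<in>B. {x + y})"

lemma minkowski_sumI: "x \<in> A \<Longrightarrow> y \<in> B \<Longrightarrow> x + y \<in> minkowski_sum A B"
  by (auto simp: minkowski_sum_def)

lemma minkowski_sum_mono: "A \<subseteq> A' \<Longrightarrow> B \<subseteq> B' \<Longrightarrow> minkowski_sum A B \<subseteq> minkowski_sum A' B'"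
  by (auto simp: minkowski_sum_def)

lemma minkowski_sum_commute: "minkowski_sum A B = minkowski_sum B A"
  by (force simp: minkowski_sum_def add.commute)

text \<open>Sums of measurable sets need not be measurable, but one open summand makes the sum open.
  The inequality is therefore proved for open sets and applied to interiors.\<close>

lemma minkowski_sum_lmeasurable:
  assumes "open A" "bounded A" "bounded B"
  shows "minkowski_sum A B \<in> lmeasurable"
  unfolding minkowski_sum_def using assms
  by (intro lmeasurable_open bounded_sums open_sums disjI1)

text \<open>As a function of ln x, ln (1 + x) is convex; this is its tangent at ln t, with slope t /
  (1 + t).\<close>

lemma ln_one_plus_ge:
  fixes x t :: real
  assumes "0 < x" "0 < t"
  shows "ln (1 + t) + t / (1 + t) * (ln x - ln t) \<le> ln (1 + x)"
proof -
  let ?p = "t / (1 + t)"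
  have "(x / t) powr ?p * 1 powr (1 / (1 + t)) \<le> ?p * (x / t) + 1 / (1 + t) * 1"
    using assms by (intro Youngs_inequality_0) (auto simp: field_simps)
  also have "\<dots> = (1 + x) / (1 + t)" using assms by (simp add: field_simps)
  finally have "(x / t) powr ?p \<le> (1 + x) / (1 + t)" by simp
  then have "ln ((x / t) powr ?p) \<le> ln ((1 + x) / (1 + t))"
    using assms by (intro ln_mono) auto
  moreover have "ln ((x / t) powr ?p) = ?p * (ln x - ln t)" using assms by (simp add: ln_powr ln_div)
  moreover have "ln ((1 + x) / (1 + t)) = ln (1 + x) - ln (1 + t)" using assms by (simp add: ln_div)
  ultimately show ?thesis by linarith
qed

text \<open>Here t is the geometric mean of the \<open>x i\<close>. With the tangents taken at t,
  the linear terms cancel in the sum of logarithms. For x i the ratios of corresponding sides this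
  is the inequality for two boxes.\<close>

lemma prod_one_plus_ge:
  fixes x :: "'i \<Rightarrow> real"
  assumes "finite I" and x: "\<And>i. i \<in> I \<Longrightarrow> 0 < x i" and t: "0 < t"
    and eq: "(\<Prod>i\<in>I. x i) = t ^ card I"
  shows "(1 + t) ^ card I \<le> (\<Prod>i\<in>I. 1 + x i)"
proof -
  have "(\<Sum>i\<in>I. ln (x i)) = real (card I) * ln t"
    using ln_prod[OF assms(1), of x] eq x t by (force simp: ln_realpow)
  then have "real (card I) * ln (1 + t) =
      real (card I) * ln (1 + t) + t / (1 + t) * ((\<Sum>i\<in>I. ln (x i)) - real (card I) * ln t)"
    by simp
  also have "\<dots> = (\<Sum>i\<in>I. ln (1 + t) + t / (1 + t) * (ln (x i) - ln t))"
    by (simp only: sum.distrib sum_distrib_left[symmetric] sum_subtractf sum_constant)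
  also have "\<dots> \<le> (\<Sum>i\<in>I. ln (1 + x i))" using x t by (intro sum_mono ln_one_plus_ge)
  also have "\<dots> = ln (\<Prod>i\<in>I. 1 + x i)"
    using assms(1) by (intro ln_prod[symmetric]) (auto dest!: x)
  finally have "ln ((1 + t) ^ card I) \<le> ln (\<Prod>i\<in>I. 1 + x i)" using t by (simp add: ln_realpow)
  moreover have "0 < (\<Prod>i\<in>I. 1 + x i)" using x by (intro prod_pos) (auto simp: add_pos_pos)
  ultimately show ?thesis using t by simp
qed

lemma measure_box:
  fixes a b :: "'a::euclidean_space"
  assumes "\<And>i. i \<in> Basis \<Longrightarrow> a \<bullet> i \<le> b \<bullet> i"
  shows "measure lebesgue (box a b) = (\<Prod>i\<in>Basis. b \<bullet> i - a \<bullet> i)"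
  using assms by (simp add: measure_lborel_box_eq inner_diff_left)

lemma box_add_subset:
  fixes a b c d :: "'a::euclidean_space"
  assumes ab: "\<And>i. i \<in> Basis \<Longrightarrow> a \<bullet> i < b \<bullet> i" and cd: "\<And>i. i \<in> Basis \<Longrightarrow> c \<bullet> i < d \<bullet> i"
  shows "box (a + c) (b + d) \<subseteq> minkowski_sum (box a b) (box c d)"
proof
  fix z assume z: "z \<in> box (a + c) (b + d)"
  \<comment> \<open>\<open>t i\<close> is the relative position of the i-th coordinate of z in the
    sum box; x and z - x are given the same relative position in their own boxes.\<close>
  define t where "t i = (z \<bullet> i - (a \<bullet> i + c \<bullet> i)) / ((b \<bullet> i - a \<bullet> i) + (d \<bullet> i - c \<bullet> i))" for i
  define x where "x = (\<Sum>i\<in>Basis. (a \<bullet> i + t i * (b \<bullet> i - a \<bullet> i)) *\<^sub>R i)"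
  have t: "0 < t i" "t i < 1" if "i \<in> Basis" for i
    using z ab[OF that] cd[OF that] that
    by (auto simp: t_def mem_box inner_add_left divide_simps)
  have teq: "z \<bullet> i - (a \<bullet> i + c \<bullet> i) = t i * (b \<bullet> i - a \<bullet> i) + t i * (d \<bullet> i - c \<bullet> i)" if "i \<in> Basis" for i
  proof -
    have "t i * ((b \<bullet> i - a \<bullet> i) + (d \<bullet> i - c \<bullet> i)) = z \<bullet> i - (a \<bullet> i + c \<bullet> i)"
      using ab[OF that] cd[OF that] by (simp add: t_def)
    then show ?thesis by (simp add: distrib_left)
  qed
  have xi: "x \<bullet> i = a \<bullet> i + t i * (b \<bullet> i - a \<bullet> i)" if "i \<in> Basis" for i
    using that by (simp add: x_def)
  have btw: "0 < t i * r \<and> t i * r < r" if "i \<in> Basis" "0 < r" for i r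
    using t[OF that(1)] that(2) by simp
  have "x \<in> box a b"
    unfolding mem_box
  proof
    fix i :: 'a assume i: "i \<in> Basis"
    show "a \<bullet> i < x \<bullet> i \<and> x \<bullet> i < b \<bullet> i"
      using btw[OF i, of "b \<bullet> i - a \<bullet> i"] ab[OF i] xi[OF i]
      by (intro conjI) linarith+
  qed
  moreover have "z - x \<in> box c d"
    unfolding mem_box
  proof
    fix i :: 'a assume i: "i \<in> Basis"
    have "(z - x) \<bullet> i = c \<bullet> i + t i * (d \<bullet> i - c \<bullet> i)"
      using teq[OF i] xi[OF i] by (simp add: inner_diff_left)
    then show "c \<bullet> i < (z - x) \<bullet> i \<and> (z - x) \<bullet> i < d \<bullet> i"
      using btw[OF i, of "d \<bullet> i - c \<bullet> i"] cd[OF i]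
      by (intro conjI) linarith+
  qed
  ultimately show "z \<in> minkowski_sum (box a b) (box c d)"
    using minkowski_sumI[of x "box a b" "z - x" "box c d"] by simp
qed

text \<open>Since V(B) = t^n V(A), the left side is (V(A)^(1/n) + V(B)^(1/n))^n. Carrying the ratio
  t as a parameter makes the bound linear in V(A), so that it can be added over the two halves of a
  cut with the same t.\<close>

lemma brunn_minkowski_box:
  fixes a b c d :: "'a::euclidean_space"
  assumes ab: "box a b \<noteq> {}" and cd: "box c d \<noteq> {}" and t: "0 < t"
    and eq: "measure lebesgue (box c d) = t ^ DIM('a) * measure lebesgue (box a b)"
  shows "(1 + t) ^ DIM('a) * measure lebesgue (box a b) \<le> measure lebesgue (minkowski_sum (box a b) (box c d))"
proof -
  have ab': "a \<bullet> i < b \<bullet> i" and cd': "c \<bullet> i < d \<bullet> i" if "i \<in> Basis" for i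
    using ab cd that by (auto simp: box_ne_empty)
  let ?x = "\<lambda>i. (d \<bullet> i - c \<bullet> i) / (b \<bullet> i - a \<bullet> i)"
  have mab: "measure lebesgue (box a b) = (\<Prod>i\<in>Basis. b \<bullet> i - a \<bullet> i)"
    using ab' by (intro measure_box less_imp_le)
  have mcd: "measure lebesgue (box c d) = (\<Prod>i\<in>Basis. d \<bullet> i - c \<bullet> i)"
    using cd' by (intro measure_box less_imp_le)
  have pos: "0 < (\<Prod>i\<in>Basis. b \<bullet> i - a \<bullet> i)" using ab' by (intro prod_pos) auto
  have "(\<Prod>i\<in>Basis. ?x i) = t ^ DIM('a)"
    using eq pos unfolding mab mcd prod_dividef by (metis less_irrefl nonzero_mult_div_cancel_right)
  then have "(1 + t) ^ DIM('a) \<le> (\<Prod>i\<in>Basis. 1 + ?x i)"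
    using ab' cd' t by (intro prod_one_plus_ge) auto
  then have "(1 + t) ^ DIM('a) * measure lebesgue (box a b)
      \<le> (\<Prod>i\<in>Basis. 1 + ?x i) * (\<Prod>i\<in>Basis. b \<bullet> i - a \<bullet> i)"
    unfolding mab using pos by (intro mult_right_mono) auto
  also have "\<dots> = (\<Prod>i\<in>Basis. (b + d) \<bullet> i - (a + c) \<bullet> i)"
    unfolding prod.distrib[symmetric]
  proof (rule prod.cong[OF refl])
    fix i :: 'a assume "i \<in> Basis"
    then show "(1 + ?x i) * (b \<bullet> i - a \<bullet> i) = (b + d) \<bullet> i - (a + c) \<bullet> i"
      using ab'[of i] by (simp add: field_simps inner_add_left)
  qed
  also have "\<dots> = measure lebesgue (box (a + c) (b + d))"
    using ab' cd' by (intro measure_box[symmetric]) (auto simp: inner_add_left intro: add_mono less_imp_le)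
  also have "\<dots> \<le> measure lebesgue (minkowski_sum (box a b) (box c d))"
    using box_add_subset[OF ab' cd']
    by (intro measure_mono_fmeasurable minkowski_sum_lmeasurable) (auto simp: bounded_box)
  finally show ?thesis .
qed

section \<open>Finite families of disjoint boxes and their cuts\<close>

lemma box_Int_halfspace_lt:
  fixes a b :: "'a::euclidean_space"
  assumes "k \<in> Basis"
  shows "box a b \<inter> {x. x \<bullet> k < c} = box a (\<Sum>i\<in>Basis. (if i = k then min (b \<bullet> k) c else b \<bullet> i) *\<^sub>R i)"
  using assms by (auto simp: mem_box split: if_splits) 

lemma box_Int_halfspace_gt:
  fixes a b :: "'a::euclidean_space"
  assumes "k \<in> Basis"
  shows "box a b \<inter> {x. c < x \<bullet> k} = box (\<Sum>i\<in>Basis. (if i = k then max (a \<bullet> k) c else a \<bullet> i) *\<^sub>R i) b"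
  using assms by (auto simp: mem_box split: if_splits) 

text \<open>Excluding empty members gives every nonempty family positive volume and lets the
  cardinality drop whenever a half-space misses a box.\<close>

definition box_family :: "'a::euclidean_space set set \<Rightarrow> bool"
  where "box_family \<D> \<longleftrightarrow> finite \<D> \<and> pairwise disjnt \<D> \<and> (\<forall>D\<in>\<D>. D \<noteq> {} \<and> (\<exists>a b. D = box a b))"

definition trim :: "'a set set \<Rightarrow> 'a set \<Rightarrow> 'a set set"
  where "trim \<D> H = (\<lambda>D. D \<inter> H) ` \<D> - {{}}"

lemma Union_trim: "\<Union>(trim \<D> H) = \<Union>\<D> \<inter> H"
  by (auto simp: trim_def)

lemma box_familyE:
  assumes "box_family \<D>" "D \<in> \<D>"
  obtains a b where "D = box a b" "box a b \<noteq> {}"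
proof -
  have "D \<noteq> {} \<and> (\<exists>a b. D = box a b)" using assms unfolding box_family_def by blast
  then show thesis using that by blast
qed

lemma box_family_trim:
  assumes "box_family \<D>" and "\<And>a b. \<exists>c d. box a b \<inter> H = box c d"
  shows "box_family (trim \<D> H)"
  using assms unfolding box_family_def trim_def pairwise_def disjnt_def
  by (fastforce simp: Int_ac)

lemma card_trim_le: "finite \<D> \<Longrightarrow> card (trim \<D> H) \<le> card \<D>"
  unfolding trim_def
  by (meson card_Diff1_le card_image_le finite_imageI le_trans card_mono Diff_subset)

lemma card_trim_less:
  assumes "finite \<D>" "D \<in> \<D>" "D \<inter> H = {}"
  shows "card (trim \<D> H) < card \<D>"
proof -
  have "trim \<D> H \<subseteq> (\<lambda>D. D \<inter> H) ` (\<D> - {D})" using assms by (auto simp: trim_def)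
  then have "card (trim \<D> H) \<le> card ((\<lambda>D. D \<inter> H) ` (\<D> - {D}))" using assms by (intro card_mono) auto
  also have "\<dots> \<le> card (\<D> - {D})" using assms by (intro card_image_le) auto
  also have "\<dots> < card \<D>" using assms by (intro card_Diff1_less)
  finally show ?thesis .
qed

lemma open_box_family: "box_family \<D> \<Longrightarrow> open (\<Union>\<D>)"
  by (intro open_Union) (metis box_family_def open_box)

lemma bounded_box_family: "box_family \<D> \<Longrightarrow> bounded (\<Union>\<D>)"
  by (auto simp: box_family_def intro!: bounded_Union)

lemma lmeasurable_box_family: "box_family \<D> \<Longrightarrow> \<Union>\<D> \<in> lmeasurable"
  by (intro lmeasurable_open bounded_box_family open_box_family)

lemma measure_open_pos:
  fixes U :: "'a::euclidean_space set"
  assumes "open U" "U \<in> lmeasurable" "U \<noteq> {}"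
  shows "0 < measure lebesgue U"
  using assms open_not_negligible[of U] negligible_iff_measure0[of U]
  by (simp add: zero_less_measure_iff)

lemma measure_box_family_pos: "box_family \<D> \<Longrightarrow> \<D> \<noteq> {} \<Longrightarrow> 0 < measure lebesgue (\<Union>\<D>)"
  by (intro measure_open_pos open_box_family lmeasurable_box_family) (auto simp: box_family_def)

lemma measure_split_hyperplane:
  fixes U :: "'a::euclidean_space set"
  assumes k: "k \<in> Basis" and U: "open U" "bounded U"
  shows "measure lebesgue U = measure lebesgue (U \<inter> {x. x \<bullet> k < c}) + measure lebesgue (U \<inter> {x. c < x \<bullet> k})"
proof -
  have op: "open {x::'a. x \<bullet> k < c}" "open {x::'a. c < x \<bullet> k}"
    by (auto simp: inner_commute[of _ k] open_halfspace_lt open_halfspace_gt)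
  then have m: "U \<inter> {x. x \<bullet> k < c} \<in> lmeasurable" "U \<inter> {x. c < x \<bullet> k} \<in> lmeasurable"
    using U by (auto intro!: lmeasurable_open)
  have "measure lebesgue U = measure lebesgue ((U \<inter> {x. x \<bullet> k < c}) \<union> (U \<inter> {x. c < x \<bullet> k}))"
  proof (rule measure_negligible_symdiff)
    show "(U \<inter> {x. x \<bullet> k < c}) \<union> (U \<inter> {x. c < x \<bullet> k}) \<in> lmeasurable" using m by auto
    show "negligible ((U \<inter> {x. x \<bullet> k < c} \<union> U \<inter> {x. c < x \<bullet> k}) - U \<union> (U - (U \<inter> {x. x \<bullet> k < c} \<union> U \<inter> {x. c < x \<bullet> k})))"
      by (rule negligible_subset[OF negligible_standard_hyperplane[OF k, of c]]) auto
  qed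
  also have "\<dots> = measure lebesgue (U \<inter> {x. x \<bullet> k < c}) + measure lebesgue (U \<inter> {x. c < x \<bullet> k})"
  proof -
    have "(U \<inter> {x. x \<bullet> k < c}) \<inter> (U \<inter> {x. c < x \<bullet> k}) = {}" by auto
    then show ?thesis using measure_Un3[OF m] by simp
  qed
  finally show ?thesis .
qed

text \<open>The explicit formula is continuous in c by inspection, which is what the intermediate
  value argument for cutting a family in a prescribed ratio needs; \<open>max 0\<close> covers
  half-spaces that miss the box.\<close>

lemma measure_box_Int_halfspace:
  fixes a b :: "'a::euclidean_space"
  assumes k: "k \<in> Basis" and ab: "box a b \<noteq> {}"
  shows "measure lebesgue (box a b \<inter> {x. x \<bullet> k < c}) =
    max 0 (min (b \<bullet> k) c - a \<bullet> k) * (\<Prod>i\<in>Basis - {k}. b \<bullet> i - a \<bullet> i)"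
proof -
  have ab': "a \<bullet> i < b \<bullet> i" if "i \<in> Basis" for i using ab that by (auto simp: box_ne_empty)
  let ?b = "\<Sum>i\<in>Basis. (if i = k then min (b \<bullet> k) c else b \<bullet> i) *\<^sub>R i"
  show ?thesis
  proof (cases "a \<bullet> k \<le> c")
    case True
    have "measure lebesgue (box a ?b) = (\<Prod>i\<in>Basis. ?b \<bullet> i - a \<bullet> i)"
      using True ab' by (intro measure_box) (auto intro: less_imp_le)
    also have "\<dots> = (?b \<bullet> k - a \<bullet> k) * (\<Prod>i\<in>Basis - {k}. ?b \<bullet> i - a \<bullet> i)"
      using k by (intro prod.remove) auto
    also have "\<dots> = max 0 (min (b \<bullet> k) c - a \<bullet> k) * (\<Prod>i\<in>Basis - {k}. b \<bullet> i - a \<bullet> i)"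
      using k True ab'[OF k] by (intro arg_cong2[where f = "(*)"] prod.cong) auto
    finally show ?thesis by (simp only: box_Int_halfspace_lt[OF k])
  next
    case False
    then have "box a b \<inter> {x. x \<bullet> k < c} = {}" using k by (force simp: mem_box)
    then show ?thesis using False by simp
  qed
qed

lemma measure_family_Int_halfspace:
  fixes \<D> :: "'a::euclidean_space set set"
  assumes \<D>: "box_family \<D>"
  shows "measure lebesgue (\<Union>\<D> \<inter> {x. x \<bullet> k < c}) = (\<Sum>D\<in>\<D>. measure lebesgue (D \<inter> {x. x \<bullet> k < c}))"
proof -
  have op: "open {x::'a. x \<bullet> k < c}" by (simp add: inner_commute[of _ k] open_halfspace_lt)
  have "\<Union>\<D> \<inter> {x. x \<bullet> k < c} = (\<Union>D\<in>\<D>. D \<inter> {x. x \<bullet> k < c})" by auto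
  also have "measure lebesgue \<dots> = (\<Sum>D\<in>\<D>. measure lebesgue (D \<inter> {x. x \<bullet> k < c}))"
  proof (rule measure_UNION')
    show "pairwise (\<lambda>i j. disjnt (i \<inter> {x. x \<bullet> k < c}) (j \<inter> {x. x \<bullet> k < c})) \<D>"
      using \<D> by (auto simp: box_family_def pairwise_def disjnt_def)
    show "D \<inter> {x. x \<bullet> k < c} \<in> lmeasurable" if D: "D \<in> \<D>" for D
    proof -
      obtain a b where "D = box a b" using box_familyE[OF \<D> D] by metis
      then show ?thesis using op by (auto intro!: lmeasurable_open bounded_Int simp: bounded_box)
    qed
  qed (use \<D> in \<open>auto simp: box_family_def\<close>)
  finally show ?thesis .
qed

lemma exists_splitting_hyperplane:
  fixes \<D> :: "'a::euclidean_space set set"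
  assumes \<D>: "box_family \<D>" and k: "k \<in> Basis" and l: "0 \<le> l" "l \<le> measure lebesgue (\<Union>\<D>)"
  obtains c where "measure lebesgue (\<Union>\<D> \<inter> {x. x \<bullet> k < c}) = l"
proof -
  obtain B where B: "\<And>x. x \<in> \<Union>\<D> \<Longrightarrow> norm x \<le> B" "0 < B"
    using bounded_box_family[OF \<D>] by (auto simp: bounded_pos)
  have xk: "\<bar>x \<bullet> k\<bar> \<le> B" if "x \<in> \<Union>\<D>" for x
    using B(1)[OF that] Basis_le_norm[OF k, of x] by linarith
  let ?f = "\<lambda>c. measure lebesgue (\<Union>\<D> \<inter> {x. x \<bullet> k < c})"
  have "continuous_on UNIV ?f"
  proof -
    have *: "continuous_on UNIV (\<lambda>c. measure lebesgue (D \<inter> {x. x \<bullet> k < c}))" if D: "D \<in> \<D>" for D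
    proof -
      obtain a b where ab: "D = box a b" "box a b \<noteq> {}" using box_familyE[OF \<D> D] by metis
      show ?thesis unfolding ab(1) measure_box_Int_halfspace[OF k ab(2)] by (intro continuous_intros)
    qed
    show ?thesis unfolding measure_family_Int_halfspace[OF \<D>] using * by (intro continuous_on_sum)
  qed
  \<comment> \<open>The half-spaces are open: at -B the half-space misses the family, while B + 1
    leaves room above the bound B so that the whole family is contained.\<close>
  then have cont: "continuous_on {- B..B + 1} ?f" by (rule continuous_on_subset) auto
  have "\<Union>\<D> \<inter> {x. x \<bullet> k < - B} = {}" using xk by fastforce
  then have "?f (- B) = 0" by (simp only: measure_empty)
  moreover have "\<Union>\<D> \<inter> {x. x \<bullet> k < B + 1} = \<Union>\<D>" using xk by fastforce
  then have "?f (B + 1) = measure lebesgue (\<Union>\<D>)" by simp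
  ultimately obtain c where "?f c = l" using IVT'[of ?f "- B" l "B + 1", OF _ _ _ cont] l B(2) by auto
  then show thesis by (rule that)
qed

text \<open>Disjoint nonempty boxes have disjoint projections to some axis; c is an endpoint lying
  between the two open intervals.\<close>

lemma separate_boxes:
  fixes \<D> :: "'a::euclidean_space set set"
  assumes \<D>: "box_family \<D>" and card: "2 \<le> card \<D>"
  obtains D E k c where "D \<in> \<D>" "E \<in> \<D>" "k \<in> Basis" "D \<subseteq> {x. x \<bullet> k < c}" "E \<subseteq> {x. c < x \<bullet> k}"
proof -
  obtain D E where DE: "D \<in> \<D>" "E \<in> \<D>" "D \<noteq> E"
    using card by (metis card_le_Suc0_iff_eq card.infinite not_less_eq_eq numeral_2_eq_2 zero_le)
  obtain a b c d where ab: "D = box a b" "E = box c d"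
    using box_familyE[OF \<D> DE(1)] box_familyE[OF \<D> DE(2)] by metis
  have ne: "box a b \<noteq> {}" "box c d \<noteq> {}" "box a b \<inter> box c d = {}"
    using DE \<D> ab by (auto simp: box_family_def pairwise_def disjnt_def)
  then obtain i where i: "i \<in> Basis" "b \<bullet> i \<le> c \<bullet> i \<or> d \<bullet> i \<le> a \<bullet> i"
    unfolding disjoint_interval box_ne_empty by (metis not_le)
  from i(2) show thesis
  proof
    assume "b \<bullet> i \<le> c \<bullet> i"
    then show thesis using i(1) ab by (intro that[OF DE(1,2) i(1), of "c \<bullet> i"]) (force simp: mem_box)+
  next
    assume "d \<bullet> i \<le> a \<bullet> i"
    then show thesis using i(1) ab by (intro that[OF DE(2,1) i(1), of "a \<bullet> i"]) (force simp: mem_box)+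
  qed
qed

text \<open>Hadwiger and Ohmann: cut the first family by a hyperplane separating two of its boxes, and the
  second one by a parallel hyperplane in the same volume ratio.\<close>

lemma brunn_minkowski_step:
  fixes \<A> \<B> :: "'a::euclidean_space set set"
  assumes A: "box_family \<A>" and B: "box_family \<B>" "\<B> \<noteq> {}" and t: "0 < t"
    and eq: "measure lebesgue (\<Union>\<B>) = t ^ DIM('a) * measure lebesgue (\<Union>\<A>)"
    and card: "2 \<le> card \<A>"
    and IH: "\<And>\<A>' \<B>' :: 'a set set. card \<A>' + card \<B>' < card \<A> + card \<B> \<Longrightarrow> box_family \<A>' \<Longrightarrow> \<A>' \<noteq> {} \<Longrightarrow>
      box_family \<B>' \<Longrightarrow> \<B>' \<noteq> {} \<Longrightarrow> measure lebesgue (\<Union>\<B>') = t ^ DIM('a) * measure lebesgue (\<Union>\<A>') \<Longrightarrow>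
      (1 + t) ^ DIM('a) * measure lebesgue (\<Union>\<A>') \<le> measure lebesgue (minkowski_sum (\<Union>\<A>') (\<Union>\<B>'))"
  shows "(1 + t) ^ DIM('a) * measure lebesgue (\<Union>\<A>) \<le> measure lebesgue (minkowski_sum (\<Union>\<A>) (\<Union>\<B>))"
proof -
  obtain D E k c where DE: "D \<in> \<A>" "E \<in> \<A>" "k \<in> Basis" "D \<subseteq> {x. x \<bullet> k < c}" "E \<subseteq> {x. c < x \<bullet> k}"
    using separate_boxes[OF A card] .
  note k = DE(3)
  have fin: "finite \<A>" "finite \<B>" using A B by (auto simp: box_family_def)
  let ?lt = "\<lambda>c. {x. x \<bullet> k < c}" and ?gt = "\<lambda>c. {x. c < x \<bullet> k}"
  let ?V = "measure lebesgue :: 'a set \<Rightarrow> real"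
  have splitA: "?V (\<Union>\<A>) = ?V (\<Union>\<A> \<inter> ?lt c) + ?V (\<Union>\<A> \<inter> ?gt c)" for c
    by (intro measure_split_hyperplane k open_box_family bounded_box_family A)
  have splitB: "?V (\<Union>\<B>) = ?V (\<Union>\<B> \<inter> ?lt c) + ?V (\<Union>\<B> \<inter> ?gt c)" for c
    by (intro measure_split_hyperplane k open_box_family bounded_box_family B)
  have "t ^ DIM('a) * ?V (\<Union>\<A> \<inter> ?lt c) \<le> ?V (\<Union>\<B>)"
    unfolding eq using t splitA[of c] by (intro mult_left_mono) auto
  then obtain c' where c': "?V (\<Union>\<B> \<inter> ?lt c') = t ^ DIM('a) * ?V (\<Union>\<A> \<inter> ?lt c)"
    using exists_splitting_hyperplane[OF B(1) k, of "t ^ DIM('a) * ?V (\<Union>\<A> \<inter> ?lt c)"] t by auto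
  have c'': "?V (\<Union>\<B> \<inter> ?gt c') = t ^ DIM('a) * ?V (\<Union>\<A> \<inter> ?gt c)"
    using splitB[of c'] splitA[of c] c' eq by (simp add: algebra_simps)
  have lt: "\<exists>u v. box a b \<inter> ?lt c = box u v" and gt: "\<exists>u v. box a b \<inter> ?gt c = box u v" for a b c
    using box_Int_halfspace_lt[OF k] box_Int_halfspace_gt[OF k] by blast+
  have fam: "box_family (trim \<A> (?lt c))" "box_family (trim \<A> (?gt c))"
      "box_family (trim \<B> (?lt c'))" "box_family (trim \<B> (?gt c'))"
    by (intro box_family_trim A B lt gt)+
  have DEne: "D \<noteq> {}" "E \<noteq> {}" using DE A by (auto simp: box_family_def)
  have neA: "trim \<A> (?lt c) \<noteq> {}" "trim \<A> (?gt c) \<noteq> {}"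
    using DE DEne by (auto simp: trim_def)
  have posA: "0 < ?V (\<Union>\<A> \<inter> ?lt c)" "0 < ?V (\<Union>\<A> \<inter> ?gt c)"
    using measure_box_family_pos[OF fam(1) neA(1)] measure_box_family_pos[OF fam(2) neA(2)]
    by (simp_all add: Union_trim)
  \<comment> \<open>Nothing places a box of the second family on a given side in advance. Both parts
    are nonempty because their volumes are positive multiples of those of the first family.\<close>
  have neB: "trim \<B> (?lt c') \<noteq> {}" "trim \<B> (?gt c') \<noteq> {}"
  proof -
    have "0 < ?V (\<Union>(trim \<B> (?lt c')))" "0 < ?V (\<Union>(trim \<B> (?gt c')))"
      using posA t unfolding Union_trim c' c'' by auto
    then show "trim \<B> (?lt c') \<noteq> {}" "trim \<B> (?gt c') \<noteq> {}" by auto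
  qed
  \<comment> \<open>Each half of the first family loses D or E and the second family gains no boxes,
    so the total count decreases.\<close>
  have "E \<inter> ?lt c = {}" "D \<inter> ?gt c = {}" using DE by force+
  then have card': "card (trim \<A> (?lt c)) + card (trim \<B> (?lt c')) < card \<A> + card \<B>"
      "card (trim \<A> (?gt c)) + card (trim \<B> (?gt c')) < card \<A> + card \<B>"
    using card_trim_less[OF fin(1) DE(2)] card_trim_less[OF fin(1) DE(1)] card_trim_le[OF fin(2)]
    by (metis add_less_le_mono)+
  let ?S1 = "minkowski_sum (\<Union>\<A> \<inter> ?lt c) (\<Union>\<B> \<inter> ?lt c')"
  let ?S2 = "minkowski_sum (\<Union>\<A> \<inter> ?gt c) (\<Union>\<B> \<inter> ?gt c')"
  let ?S = "minkowski_sum (\<Union>\<A>) (\<Union>\<B>)"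
  have 1: "(1 + t) ^ DIM('a) * ?V (\<Union>\<A> \<inter> ?lt c) \<le> ?V ?S1"
    using IH[OF card'(1) fam(1) neA(1) fam(3) neB(1)] c' by (simp add: Union_trim)
  have 2: "(1 + t) ^ DIM('a) * ?V (\<Union>\<A> \<inter> ?gt c) \<le> ?V ?S2"
    using IH[OF card'(2) fam(2) neA(2) fam(4) neB(2)] c'' by (simp add: Union_trim)
  have m1: "?S1 \<in> lmeasurable" 
    using minkowski_sum_lmeasurable[OF open_box_family[OF fam(1)] bounded_box_family[OF fam(1)] bounded_box_family[OF fam(3)]]
    by (simp add: Union_trim)
  have m2: "?S2 \<in> lmeasurable" 
    using minkowski_sum_lmeasurable[OF open_box_family[OF fam(2)] bounded_box_family[OF fam(2)] bounded_box_family[OF fam(4)]]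
    by (simp add: Union_trim)
  have m: "?S \<in> lmeasurable"
    by (intro minkowski_sum_lmeasurable open_box_family bounded_box_family A B)
  \<comment> \<open>The partial sums lie on opposite sides of the hyperplane at c + c'.\<close>
  have disj: "?S1 \<inter> ?S2 = {}"
  proof -
    have "x \<bullet> k < c + c'" if "x \<in> ?S1" for x
      using that by (auto simp: minkowski_sum_def inner_add_left intro!: add_strict_mono)
    moreover have "c + c' < x \<bullet> k" if "x \<in> ?S2" for x
      using that by (auto simp: minkowski_sum_def inner_add_left intro!: add_strict_mono)
    ultimately show ?thesis by fastforce
  qed
  have "(1 + t) ^ DIM('a) * ?V (\<Union>\<A>) \<le> ?V ?S1 + ?V ?S2"
    using 1 2 splitA[of c] by (simp add: distrib_left)
  also have "\<dots> = ?V (?S1 \<union> ?S2)"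
    using measure_Un3[OF m1 m2] disj by simp
  also have "\<dots> \<le> ?V ?S"
    using m m1 m2 by (intro measure_mono_fmeasurable fmeasurableD fmeasurable.Un Un_least minkowski_sum_mono) auto
  finally show ?thesis .
qed

lemma brunn_minkowski_families:
  fixes \<A> \<B> :: "'a::euclidean_space set set"
  assumes "box_family \<A>" "\<A> \<noteq> {}" "box_family \<B>" "\<B> \<noteq> {}" "0 < t"
    and "measure lebesgue (\<Union>\<B>) = t ^ DIM('a) * measure lebesgue (\<Union>\<A>)"
  shows "(1 + t) ^ DIM('a) * measure lebesgue (\<Union>\<A>) \<le> measure lebesgue (minkowski_sum (\<Union>\<A>) (\<Union>\<B>))"
  using assms
proof (induction "card \<A> + card \<B>" arbitrary: \<A> \<B> t rule: less_induct)
  case less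
  have fin: "finite \<A>" "finite \<B>" using less.prems by (auto simp: box_family_def)
  then have pos: "card \<A> > 0" "card \<B> > 0" using less.prems by (auto simp: card_gt_0_iff)
  consider "2 \<le> card \<A>" | "2 \<le> card \<B>" | "card \<A> = 1" "card \<B> = 1" using pos by linarith
  then show ?case
  proof cases
    case 1
    show ?thesis
    proof (rule brunn_minkowski_step[OF less.prems(1,3,4,5,6) 1])
      fix \<A>' \<B>' :: "'a set set"
      assume *: "card \<A>' + card \<B>' < card \<A> + card \<B>" "box_family \<A>'" "\<A>' \<noteq> {}" "box_family \<B>'" "\<B>' \<noteq> {}"
        "measure lebesgue (\<Union>\<B>') = t ^ DIM('a) * measure lebesgue (\<Union>\<A>')"
      show "(1 + t) ^ DIM('a) * measure lebesgue (\<Union>\<A>') \<le> measure lebesgue (minkowski_sum (\<Union>\<A>') (\<Union>\<B>'))"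
        using * less.prems(5) by (intro less.hyps)
    qed
  next
    case 2
    \<comment> \<open>Exchanging the families inverts the ratio, so the induction must range over
      all t; (1 + 1/t)^n t^n = (1 + t)^n converts the bound back.\<close>
    let ?s = "1 / t"
    have "(1 + ?s) ^ DIM('a) * measure lebesgue (\<Union>\<B>) \<le> measure lebesgue (minkowski_sum (\<Union>\<B>) (\<Union>\<A>))"
    proof (rule brunn_minkowski_step[OF less.prems(3,1,2) _ _ 2])
      show "0 < ?s" using less.prems(5) by simp
      show "measure lebesgue (\<Union>\<A>) = ?s ^ DIM('a) * measure lebesgue (\<Union>\<B>)"
        unfolding less.prems(6) using less.prems(5) by (simp add: power_one_over)
      fix \<A>' \<B>' :: "'a set set"
      assume *: "card \<A>' + card \<B>' < card \<B> + card \<A>" "box_family \<A>'" "\<A>' \<noteq> {}" "box_family \<B>'" "\<B>' \<noteq> {}"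
        "measure lebesgue (\<Union>\<B>') = ?s ^ DIM('a) * measure lebesgue (\<Union>\<A>')"
      have "card \<A>' + card \<B>' < card \<A> + card \<B>" "0 < ?s" using *(1) less.prems(5) by simp_all
      then show "(1 + ?s) ^ DIM('a) * measure lebesgue (\<Union>\<A>') \<le> measure lebesgue (minkowski_sum (\<Union>\<A>') (\<Union>\<B>'))"
        using *(2-6) by (intro less.hyps)
    qed
    moreover have "(1 + ?s) ^ DIM('a) * t ^ DIM('a) = (1 + t) ^ DIM('a)"
      using less.prems(5) by (simp add: power_mult_distrib[symmetric] field_simps)
    ultimately show ?thesis
      unfolding less.prems(6) mult.assoc[symmetric] minkowski_sum_commute[of "\<Union>\<B>"] by simp
  next
    case 3
    then obtain D E where DE: "\<A> = {D}" "\<B> = {E}" by (meson card_1_singletonE)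
    then have "box_family {D}" "box_family {E}" using less.prems by auto
    then obtain a b c d where "D = box a b" "E = box c d" "box a b \<noteq> {}" "box c d \<noteq> {}"
      using box_familyE[of "{D}" D] box_familyE[of "{E}" E] by (metis singletonI)
    then show ?thesis using less.prems brunn_minkowski_box[of a b c d t] DE by simp
  qed
qed

section \<open>Approximation of open sets from inside\<close>

lemma open_approx_box_family:
  fixes U :: "'a::euclidean_space set"
  assumes U: "open U" "bounded U" and e: "0 < e"
  obtains \<D> where "box_family \<D>" "\<Union>\<D> \<subseteq> U" "measure lebesgue U - e < measure lebesgue (\<Union>\<D>)"
proof -
  obtain a where a: "U \<subseteq> cbox (- a) a"
    using bounded_subset_cbox_symmetric[OF U(2)] .
  obtain p :: 'a where p: "U \<subseteq> cbox (- p) p" "box (- p) p \<noteq> {}"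
  proof -
    \<comment> \<open>Each half-side is enlarged by 1 so that the surrounding box has nonempty
      interior.\<close>
    let ?p = "\<Sum>i\<in>Basis. (\<bar>a \<bullet> i\<bar> + 1) *\<^sub>R (i::'a)"
    have "cbox (- a) a \<subseteq> cbox (- ?p) ?p"
    proof
      fix x assume "x \<in> cbox (- a) a"
      then show "x \<in> cbox (- ?p) ?p" by (fastforce simp: mem_box)
    qed
    moreover have "box (- ?p) ?p \<noteq> {}" by (auto simp: box_ne_empty)
    ultimately show thesis using a that[of ?p] by blast
  qed
  \<comment> \<open>This gauge forces each covering box, being tagged by a point of U, to lie inside
    U.\<close>
  have "gauge (\<lambda>x. if x \<in> U then U else UNIV)" using U by (auto simp: gauge_def)
  from covering_lemma[OF p this] obtain \<D> where \<D>: "countable \<D>"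
    "\<And>K. K \<in> \<D> \<Longrightarrow> interior K \<noteq> {} \<and> (\<exists>c d. K = cbox c d)"
    "pairwise (\<lambda>A B. interior A \<inter> interior B = {}) \<D>"
    "\<And>K. K \<in> \<D> \<Longrightarrow> \<exists>x\<in>U \<inter> K. K \<subseteq> (if x \<in> U then U else UNIV)"
    "U \<subseteq> \<Union>\<D>" by metis
  have sub: "K \<subseteq> U" if "K \<in> \<D>" for K using \<D>(4)[OF that] by auto
  have Ueq: "\<Union>\<D> = U" using sub \<D>(5) by blast
  have meas: "K \<in> lmeasurable" if "K \<in> \<D>" for K using \<D>(2)[OF that] by auto
  have "\<not> (\<forall>\<E>. \<E> \<subseteq> \<D> \<longrightarrow> finite \<E> \<longrightarrow> measure lebesgue (\<Union>\<E>) \<le> measure lebesgue U - e)"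
    using measure_Union_bound[OF \<D>(1) meas, of "measure lebesgue U - e"] e unfolding Ueq by auto
  then obtain \<E> where \<E>: "\<E> \<subseteq> \<D>" "finite \<E>" "measure lebesgue U - e < measure lebesgue (\<Union>\<E>)"
    by (auto simp: not_le)
  have box: "\<exists>c d. K = cbox c d \<and> interior K = box c d" if KE: "K \<in> \<E>" for K
  proof -
    obtain c d where "K = cbox c d" using \<D>(2) KE \<E>(1) by blast
    then show ?thesis using interior_cbox[of c d] by blast
  qed
  have fam: "box_family (interior ` \<E>)"
    unfolding box_family_def
  proof (intro conjI ballI)
    show "finite (interior ` \<E>)" using \<E>(2) by simp
    show "pairwise disjnt (interior ` \<E>)"
    proof (rule pairwiseI)
      fix A B assume "A \<in> interior ` \<E>" "B \<in> interior ` \<E>" "A \<noteq> B"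
      then show "disjnt A B" using pairwiseD[OF \<D>(3)] \<E>(1) unfolding disjnt_def by blast
    qed
    fix D assume "D \<in> interior ` \<E>"
    then obtain K where K: "K \<in> \<E>" "D = interior K" by blast
    show "D \<noteq> {}" using K \<D>(2) \<E>(1) by blast
    show "\<exists>a b. D = box a b" using K(2) box[OF K(1)] by blast
  qed
  \<comment> \<open>Passing to interiors makes the boxes disjoint and removes only finitely many
    null boundaries.\<close>
  have "measure lebesgue (\<Union>(interior ` \<E>)) = measure lebesgue (\<Union>\<E>)"
  proof (rule measure_negligible_symdiff)
    show "\<Union>\<E> \<in> lmeasurable" using \<E> meas by (intro fmeasurable.finite_Union) auto
    have "negligible (\<Union>K\<in>\<E>. K - interior K)"
    proof (rule negligible_Union)
      show "finite ((\<lambda>K. K - interior K) ` \<E>)" using \<E>(2) by simp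
      fix N assume "N \<in> (\<lambda>K. K - interior K) ` \<E>"
      then obtain K where K: "K \<in> \<E>" "N = K - interior K" by blast
      then show "negligible N" using box[OF K(1)] negligible_frontier_interval by metis
    qed
    then show "negligible (\<Union>\<E> - \<Union>(interior ` \<E>) \<union> (\<Union>(interior ` \<E>) - \<Union>\<E>))"
      by (rule negligible_subset) (use interior_subset in blast)
  qed
  with fam \<E> show thesis
    using sub interior_subset by (intro that[of "interior ` \<E>"]) fastforce+
qed

lemma brunn_minkowski_open:
  fixes A B :: "'a::euclidean_space set"
  assumes A: "open A" "bounded A" "A \<noteq> {}" and B: "open B" "bounded B" "B \<noteq> {}"
  shows "(root DIM('a) (measure lebesgue A) + root DIM('a) (measure lebesgue B)) ^ DIM('a)
    \<le> measure lebesgue (minkowski_sum A B)"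
proof -
  let ?N = "DIM('a)" and ?V = "measure lebesgue :: 'a set \<Rightarrow> real"
  \<comment> \<open>The error is relative and at most the whole volume of U, so that each
    approximating family has positive volume and is nonempty, also for n = 0.\<close>
  have approx: "\<exists>a\<le>?V U. ?V U * (1 - inverse (real (Suc n))) < a \<and> (\<exists>\<D>. box_family \<D> \<and> \<D> \<noteq> {} \<and> \<Union>\<D> \<subseteq> U \<and> a = ?V (\<Union>\<D>))"
    if U: "open U" "bounded U" "U \<noteq> {}" for U and n :: nat
  proof -
    have pos: "0 < ?V U" using U by (intro measure_open_pos lmeasurable_open)
    then obtain \<D> where \<D>: "box_family \<D>" "\<Union>\<D> \<subseteq> U" "?V U - ?V U * inverse (real (Suc n)) < ?V (\<Union>\<D>)"
      using open_approx_box_family[OF U(1,2), of "?V U * inverse (real (Suc n))"] by auto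
    have "inverse (real (Suc n)) \<le> 1" by (simp add: field_simps)
    then have "0 \<le> ?V U * (1 - inverse (real (Suc n)))" using pos by simp
    then have "0 < ?V (\<Union>\<D>)" using \<D>(3) by (simp add: algebra_simps)
    then have "\<D> \<noteq> {}" by auto
    moreover have "?V (\<Union>\<D>) \<le> ?V U"
      using \<D> U by (intro measure_mono_fmeasurable fmeasurableD[OF lmeasurable_box_family] lmeasurable_open)
    ultimately show ?thesis using \<D> by (intro exI[of _ "?V (\<Union>\<D>)"]) (auto simp: algebra_simps)
  qed
  have lim: "\<exists>f. f \<longlonglongrightarrow> ?V U \<and> (\<forall>n. \<exists>\<D>. box_family \<D> \<and> \<D> \<noteq> {} \<and> \<Union>\<D> \<subseteq> U \<and> f n = ?V (\<Union>\<D>))"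
    if U: "open U" "bounded U" "U \<noteq> {}" for U
  proof -
    obtain f where f: "\<And>n. f n \<le> ?V U" "\<And>n. ?V U * (1 - inverse (real (Suc n))) < f n"
      "\<And>n. \<exists>\<D>. box_family \<D> \<and> \<D> \<noteq> {} \<and> \<Union>\<D> \<subseteq> U \<and> f n = ?V (\<Union>\<D>)"
      using approx[OF U] by metis
    have "(\<lambda>n. ?V U * (1 - inverse (real (Suc n)))) \<longlonglongrightarrow> ?V U * (1 - 0)"
      by (intro tendsto_intros LIMSEQ_inverse_real_of_nat)
    then have lower: "(\<lambda>n. ?V U * (1 - inverse (real (Suc n)))) \<longlonglongrightarrow> ?V U" by simp
    have "f \<longlonglongrightarrow> ?V U"
      by (rule real_tendsto_sandwich[OF _ _ lower tendsto_const])
        (rule always_eventually, rule allI, use f(1,2) less_imp_le in blast)+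
    with f(3) show ?thesis by blast
  qed
  obtain f where f: "f \<longlonglongrightarrow> ?V A" "\<And>n. \<exists>\<D>. box_family \<D> \<and> \<D> \<noteq> {} \<and> \<Union>\<D> \<subseteq> A \<and> f n = ?V (\<Union>\<D>)"
    using lim[OF A] by blast
  obtain g where g: "g \<longlonglongrightarrow> ?V B" "\<And>n. \<exists>\<D>. box_family \<D> \<and> \<D> \<noteq> {} \<and> \<Union>\<D> \<subseteq> B \<and> g n = ?V (\<Union>\<D>)"
    using lim[OF B] by blast
  have le: "(root ?N (f n) + root ?N (g n)) ^ ?N \<le> ?V (minkowski_sum A B)" for n
  proof -
    obtain \<A> \<B> where fam: "box_family \<A>" "\<A> \<noteq> {}" "\<Union>\<A> \<subseteq> A" "f n = ?V (\<Union>\<A>)"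
      "box_family \<B>" "\<B> \<noteq> {}" "\<Union>\<B> \<subseteq> B" "g n = ?V (\<Union>\<B>)" using f(2) g(2) by metis
    have pos: "0 < f n" "0 < g n" 
      using measure_box_family_pos[OF fam(1,2)] measure_box_family_pos[OF fam(5,6)] fam(4,8) by simp_all
    define t where "t = root ?N (g n) / root ?N (f n)"
    have t: "0 < t" using pos by (simp add: t_def)
    have "g n = t ^ ?N * f n" using pos by (simp add: t_def power_divide real_root_pow_pos)
    then have "(1 + t) ^ ?N * f n \<le> ?V (minkowski_sum (\<Union>\<A>) (\<Union>\<B>))"
      using brunn_minkowski_families[OF fam(1,2,5,6) t] fam by simp
    also have "\<dots> \<le> ?V (minkowski_sum A B)"
      using fam A B by (intro measure_mono_fmeasurable minkowski_sum_mono minkowski_sum_lmeasurable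
          fmeasurableD[OF minkowski_sum_lmeasurable] open_box_family bounded_box_family)
    also have "(1 + t) ^ ?N * f n = ((1 + t) * root ?N (f n)) ^ ?N"
      using pos by (simp add: power_mult_distrib real_root_pow_pos)
    also have "(1 + t) * root ?N (f n) = root ?N (f n) + root ?N (g n)"
      using pos by (simp add: t_def field_simps)
    finally show ?thesis .
  qed
  have "(\<lambda>n. (root ?N (f n) + root ?N (g n)) ^ ?N) \<longlonglongrightarrow> (root ?N (?V A) + root ?N (?V B)) ^ ?N"
    by (intro tendsto_intros f g)
  then show ?thesis by (rule LIMSEQ_le_const2) (use le in blast)
qed

subsection \<open>Minkowski's first inequality\<close>

lemma bdd_above_inner_image: "compact K \<Longrightarrow> bdd_above ((\<lambda>x. x \<bullet> u) ` K)" for K :: "'a::euclidean_space set"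
  by (intro bounded_imp_bdd_above compact_imp_bounded compact_continuous_image continuous_intros)

lemma inner_le_support_fun: "compact K \<Longrightarrow> x \<in> K \<Longrightarrow> x \<bullet> u \<le> support_fun K u"
  unfolding support_fun_def by (rule cSUP_upper[OF _ bdd_above_inner_image])

lemma support_fun_le:
  "K \<noteq> {} \<Longrightarrow> (\<And>x. x \<in> K \<Longrightarrow> x \<bullet> u \<le> c) \<Longrightarrow> support_fun K u \<le> c"
  unfolding support_fun_def by (rule cSUP_least)

lemma support_fun_scale:
  fixes K :: "'a::euclidean_space set"
  assumes K: "compact K" "K \<noteq> {}" and c: "0 < c"
  shows "support_fun ((\<lambda>x. c *\<^sub>R x) ` K) u = c * support_fun K u"
proof (rule antisym)
  show "support_fun ((\<lambda>x. c *\<^sub>R x) ` K) u \<le> c * support_fun K u"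
    using K c by (intro support_fun_le) (auto intro: inner_le_support_fun)
  have comp: "compact ((\<lambda>x. c *\<^sub>R x) ` K)" using K by (intro compact_scaling)
  have "support_fun K u \<le> support_fun ((\<lambda>x. c *\<^sub>R x) ` K) u / c"
  proof (rule support_fun_le[OF K(2)])
    fix x assume "x \<in> K"
    then have "(c *\<^sub>R x) \<bullet> u \<le> support_fun ((\<lambda>x. c *\<^sub>R x) ` K) u"
      by (intro inner_le_support_fun comp) auto
    then show "x \<bullet> u \<le> support_fun ((\<lambda>x. c *\<^sub>R x) ` K) u / c" using c by (simp add: field_simps)
  qed
  then show "c * support_fun K u \<le> support_fun ((\<lambda>x. c *\<^sub>R x) ` K) u" using c by (simp add: field_simps)
qed

lemma continuous_on_support_fun:
  fixes K :: "'a::euclidean_space set"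
  assumes K: "compact K" "K \<noteq> {}"
  shows "continuous_on A (support_fun K)"
proof -
  obtain B where B: "\<And>x. x \<in> K \<Longrightarrow> norm x \<le> B" "0 < B"
    using compact_imp_bounded[OF K(1)] by (auto simp: bounded_pos)
  have 1: "support_fun K u \<le> support_fun K v + B * norm (u - v)" for u v
  proof (rule support_fun_le[OF K(2)])
    fix x assume x: "x \<in> K"
    have "x \<bullet> (u - v) \<le> norm x * norm (u - v)" by (rule norm_cauchy_schwarz)
    also have "\<dots> \<le> B * norm (u - v)" using B(1)[OF x] by (intro mult_right_mono) auto
    finally show "x \<bullet> u \<le> support_fun K v + B * norm (u - v)"
      using inner_le_support_fun[OF K(1) x, of v] by (simp add: inner_diff_right)
  qed
  have "B-lipschitz_on A (support_fun K)"
  proof (rule lipschitz_onI)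
    fix u v
    show "dist (support_fun K u) (support_fun K v) \<le> B * dist u v"
      using 1[of u v] 1[of v u] by (simp add: dist_norm norm_minus_commute[of v u] abs_le_iff)
  qed (use B in simp)
  then show ?thesis by (rule lipschitz_on_continuous_on)
qed

lemma measurable_support_fun:
  "compact K \<Longrightarrow> K \<noteq> {} \<Longrightarrow> support_fun K \<in> borel_measurable borel"
  by (intro borel_measurable_continuous_onI continuous_on_support_fun)

lemma support_fun_bounds:
  fixes K :: "'a::euclidean_space set"
  assumes K: "compact K" and int: "0 \<in> interior K"
  obtains r R where "0 < r" "cball 0 r \<subseteq> K" "\<And>x. x \<in> K \<Longrightarrow> norm x \<le> R"
    "\<And>u. u \<in> sphere 0 1 \<Longrightarrow> r \<le> support_fun K u \<and> support_fun K u \<le> R"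
proof -
  obtain r where r: "0 < r" "cball 0 r \<subseteq> K" using int by (auto simp: mem_interior_cball)
  obtain R where R: "\<And>x. x \<in> K \<Longrightarrow> norm x \<le> R"
    using compact_imp_bounded[OF K] by (auto simp: bounded_iff)
  have "r \<le> support_fun K u \<and> support_fun K u \<le> R" if u: "u \<in> sphere 0 1" for u
  proof
    have nu: "norm u = 1" using u by simp
    have "r *\<^sub>R u \<in> K" using r nu by auto
    then have "(r *\<^sub>R u) \<bullet> u \<le> support_fun K u" by (rule inner_le_support_fun[OF K])
    then show "r \<le> support_fun K u" using nu by (simp add: dot_square_norm)
    show "support_fun K u \<le> R"
    proof (rule support_fun_le)
      show "K \<noteq> {}" using r(1,2) by auto
      fix x assume "x \<in> K"
      then show "x \<bullet> u \<le> R" using norm_cauchy_schwarz[of x u] nu R[of x] by simp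
    qed
  qed
  with r R that show thesis by blast
qed

section \<open>Volumes of dilates and of convex bodies\<close>

lemma measure_scaled:
  fixes S :: "'a::euclidean_space set"
  assumes "0 \<le> c"
  shows "measure lebesgue ((\<lambda>x. c *\<^sub>R x) ` S) = c ^ DIM('a) * measure lebesgue S"
  using measure_lebesgue_affine[of c 0 S] assms by simp

lemma measure_interior_convex:
  "convex S \<Longrightarrow> bounded S \<Longrightarrow> measure lebesgue (interior S) = measure lebesgue S"
  by (intro measure_interior negligible_convex_frontier)

text \<open>The part of the interior of B outside A is open and of volume 0, hence empty; a closed
  convex set with interior points is the closure of its interior. This is the only rigidity
  statement behind the equality case.\<close>

lemma compact_convex_eqI:
  fixes A B :: "'a::euclidean_space set"
  assumes A: "compact A" and B: "compact B" "convex B" "interior B \<noteq> {}"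
    and sub: "A \<subseteq> B" and le: "measure lebesgue B \<le> measure lebesgue A"
  shows "A = B"
proof -
  have op: "open (interior B - A)" using A by (intro open_Diff open_interior compact_imp_closed)
  moreover have "bounded (interior B - A)"
    using B(1) by (intro bounded_diff bounded_interior compact_imp_bounded)
  ultimately have m: "A \<in> lmeasurable" "interior B - A \<in> lmeasurable"
    using A by (auto intro: lmeasurable_compact lmeasurable_open)
  have "measure lebesgue A + measure lebesgue (interior B - A) = measure lebesgue (A \<union> (interior B - A))"
    using measure_Un3[OF m] by simp
  also have "\<dots> \<le> measure lebesgue B"
    using sub interior_subset[of B]
    by (intro measure_mono_fmeasurable[OF _ fmeasurableD[OF fmeasurable.Un[OF m]] lmeasurable_compact[OF B(1)]]) auto
  finally have "measure lebesgue (interior B - A) \<le> 0" using le by simp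
  then have "interior B - A = {}"
    using measure_open_pos[OF op m(2)] by linarith
  then have "closure (interior B) \<subseteq> A"
    using A by (intro closure_minimal compact_imp_closed) auto
  then show ?thesis
    using sub convex_closure_interior[OF B(2,3)] B(1) by (auto simp: closure_closed compact_imp_closed)
qed

text \<open>Bernoulli's inequality at x / a, scaled by a^n. It plays the part of the derivative of
  the Brunn-Minkowski bound, but holds for every increment.\<close>

lemma bernoulli_power:
  fixes a x :: real
  assumes "0 < a" "0 \<le> x" "0 < n"
  shows "real n * a ^ (n - 1) * x \<le> (a + x) ^ n - a ^ n"
proof -
  have "a ^ n * (1 + real n * (x / a)) \<le> a ^ n * (1 + x / a) ^ n"
    using assms by (intro mult_left_mono Bernoulli_inequality) (auto simp: order_trans[of "-1" 0])
  also have "\<dots> = (a + x) ^ n"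
    using assms by (simp add: power_mult_distrib[symmetric] field_simps)
  also have "a ^ n * (1 + real n * (x / a)) = a ^ n + real n * a ^ (n - 1) * x"
    using assms by (cases n) (auto simp: field_simps)
  finally show ?thesis by simp
qed

section \<open>Collars and Minkowski's first inequality\<close>

context compact_convex
begin

text \<open>For x = l + \<epsilon> k outside L, with nearest point p, distance r and direction u,
  take inner products with u: p . u + r = l . u + \<epsilon> k . u, and l . u \<le> p . u leaves r
  \<le> \<epsilon> h_K(u).\<close>

lemma minkowski_sum_subset_collar:
  assumes K: "compact K" and "0 \<le> \<epsilon>"
  shows "minkowski_sum L ((\<lambda>x. \<epsilon> *\<^sub>R x) ` K) \<subseteq> L \<union> collar (support_fun K) 0 \<epsilon>"
proof
  fix x assume "x \<in> minkowski_sum L ((\<lambda>x. \<epsilon> *\<^sub>R x) ` K)"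
  then obtain l k where lk: "l \<in> L" "k \<in> K" "x = l + \<epsilon> *\<^sub>R k" by (auto simp: minkowski_sum_def)
  show "x \<in> L \<union> collar (support_fun K) 0 \<epsilon>"
  proof (cases "x \<in> L")
    case False
    let ?u = "outer_dir L x" and ?p = "closest_point L x" and ?r = "infdist x L"
    have r: "0 < ?r" using infdist_pos_not_in_closed[OF closed_L nonempty_L False] .
    have uu: "?u \<bullet> ?u = 1" using norm_outer_dir[OF r] by (simp add: dot_square_norm)
    have "?p \<bullet> ?u + ?r = x \<bullet> ?u"
      using decompose[of x] uu by (metis inner_add_left inner_scaleR_left mult.right_neutral)
    also have "\<dots> = l \<bullet> ?u + \<epsilon> * (k \<bullet> ?u)" by (simp add: lk(3) inner_add_left)
    also have "\<dots> \<le> ?p \<bullet> ?u + \<epsilon> * support_fun K ?u"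
      using lk assms by (intro add_mono mult_left_mono inner_outer_dir_le inner_le_support_fun)
    finally show ?thesis using r by (simp add: collar_def)
  qed simp
qed

text \<open>The left side is n V(L)^((n-1)/n) V(K)^(1/n), the linear coefficient in \<epsilon> of
  the Brunn-Minkowski bound for L + \<epsilon> K. The sum is formed from interiors, whose volumes
  agree with those of the bodies, and exceeds L only inside the collar.\<close>

lemma minkowski_first:
  assumes L: "interior L \<noteq> {}" and K: "compact K" "convex K" "0 \<in> interior K"
  shows "real DIM('a) * root DIM('a) (measure lebesgue L) ^ (DIM('a) - 1) * root DIM('a) (measure lebesgue K)
    \<le> (\<integral>u. support_fun K u \<partial>surface_area_measure L)"
proof -
  let ?n = "DIM('a)"
  let ?a = "root ?n (measure lebesgue L)" and ?b = "root ?n (measure lebesgue K)"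
  obtain r R where rR: "0 < r" "\<And>u. u \<in> sphere 0 1 \<Longrightarrow> r \<le> support_fun K u \<and> support_fun K u \<le> R"
    using support_fun_bounds[OF K(1,3)] by metis
  have ne: "K \<noteq> {}" using K(3) interior_subset by auto
  have h: "support_fun K \<in> borel_measurable borel" using K(1) ne by (rule measurable_support_fun)
  have bd: "0 \<le> support_fun K u \<and> support_fun K u \<le> R" if "u \<in> sphere 0 1" for u
    using rR(1) rR(2)[OF that] by linarith
  have VL: "measure lebesgue (interior L) = measure lebesgue L"
    by (intro measure_interior_convex convex_L compact_imp_bounded compact_L)
  have VK: "measure lebesgue (interior K) = measure lebesgue K"
    by (intro measure_interior_convex K compact_imp_bounded)
  have "0 < measure lebesgue (interior L)"
    using L compact_imp_bounded[OF compact_L] bounded_interior by (intro measure_open_pos lmeasurable_open) auto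
  then have posa: "0 < ?a" unfolding VL by (intro real_root_gt_zero) auto
  have posb: "0 \<le> ?b" by (intro real_root_ge_zero) auto
  have powa: "?a ^ ?n = measure lebesgue L" by (intro real_root_pow_pos2) auto
  show ?thesis
  proof (rule integral_ge_of_collar[OF h bd])
    fix \<epsilon> :: real assume \<epsilon>: "0 < \<epsilon>"
    let ?B = "(\<lambda>x. \<epsilon> *\<^sub>R x) ` interior K"
    have C: "collar (support_fun K) 0 \<epsilon> \<in> lmeasurable"
      using \<epsilon> bd by (intro collar_lmeasurable[OF h, of R]) auto
    have Lm: "L \<in> lmeasurable" using compact_L by (rule lmeasurable_compact)
    have B: "open ?B" "bounded ?B" "?B \<noteq> {}"
      using \<epsilon> K(3) open_scaling[OF _ open_interior, of \<epsilon> K]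
        bounded_scaling[OF bounded_interior[OF compact_imp_bounded[OF K(1)]], of \<epsilon>] by auto
    have "root ?n (measure lebesgue ?B) = \<epsilon> * ?b"
      using \<epsilon> by (simp add: measure_scaled VK real_root_mult real_root_power_cancel del: measure_completion)
    then have "(?a + \<epsilon> * ?b) ^ ?n \<le> measure lebesgue (minkowski_sum (interior L) ?B)"
      using brunn_minkowski_open[OF open_interior bounded_interior[OF compact_imp_bounded[OF compact_L]] L B]
      unfolding VL by metis
    also have "\<dots> \<le> measure lebesgue (L \<union> collar (support_fun K) 0 \<epsilon>)"
    proof (rule measure_mono_fmeasurable)
      have "minkowski_sum (interior L) ?B \<subseteq> minkowski_sum L ((\<lambda>x. \<epsilon> *\<^sub>R x) ` K)"
        by (intro minkowski_sum_mono image_mono interior_subset)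
      also have "\<dots> \<subseteq> L \<union> collar (support_fun K) 0 \<epsilon>"
        using \<epsilon> by (intro minkowski_sum_subset_collar K(1)) auto
      finally show "minkowski_sum (interior L) ?B \<subseteq> L \<union> collar (support_fun K) 0 \<epsilon>" .
      show "minkowski_sum (interior L) ?B \<in> sets lebesgue"
        by (intro fmeasurableD minkowski_sum_lmeasurable[OF open_interior _ B(2)] bounded_interior
            compact_imp_bounded compact_L)
    qed (intro fmeasurable.Un Lm C)
    also have "\<dots> \<le> measure lebesgue L + measure lebesgue (collar (support_fun K) 0 \<epsilon>)"
      using C Lm by (intro measure_Un_le) (auto dest: fmeasurableD)
    finally have "(?a + \<epsilon> * ?b) ^ ?n - ?a ^ ?n \<le> measure lebesgue (collar (support_fun K) 0 \<epsilon>)"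
      unfolding powa by simp
    moreover have "real ?n * ?a ^ (?n - 1) * (\<epsilon> * ?b) \<le> (?a + \<epsilon> * ?b) ^ ?n - ?a ^ ?n"
      using posa posb \<epsilon> by (intro bernoulli_power) auto
    ultimately show "real ?n * ?a ^ (?n - 1) * ?b * \<epsilon> \<le> measure lebesgue (collar (support_fun K) 0 \<epsilon>)"
      by (simp add: mult_ac)
  qed
qed

section \<open>The mixed volume of a body with itself\<close>

lemma outer_dir_supports: "support_fun L (outer_dir L x) = closest_point L x \<bullet> outer_dir L x"
  by (intro antisym support_fun_le nonempty_L inner_outer_dir_le inner_le_support_fun compact_L closest_in)

lemma scaled_in:
  assumes "0 \<in> L" "x \<in> L" "1 \<le> c"
  shows "(1 / c) *\<^sub>R x \<in> L"
  using convexD_alt[OF convex_L assms(1,2), of "1 / c"] assms(3) by simp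

text \<open>The ball of radius s is s/r times a ball contained in L, so the parallel body lies in L
  + (s/r) L, which is (1 + s/r) L by convexity.\<close>

lemma parallel_subset_scaled:
  assumes r: "0 < r" "cball 0 r \<subseteq> L" and s: "0 < s"
  shows "{x. infdist x L \<le> s} \<subseteq> (\<lambda>x. (1 + s / r) *\<^sub>R x) ` L"
proof
  fix x assume "x \<in> {x. infdist x L \<le> s}"
  then have x: "norm (x - closest_point L x) \<le> s" by (simp add: infdist_eq)
  let ?y = "(r / s) *\<^sub>R (x - closest_point L x)" and ?c = "1 + s / r"
  have c: "0 < ?c" using r s by (simp add: add_pos_pos)
  have "norm ?y = r / s * norm (x - closest_point L x)" using r s by simp
  also have "\<dots> \<le> r / s * s" using x r s by (intro mult_left_mono) auto
  finally have "norm ?y \<le> r" using s by simp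
  then have y: "?y \<in> L" using r by auto
  have "1 / ?c + s / r / ?c = 1" using c by (metis add_divide_distrib divide_self less_irrefl)
  then have "(1 / ?c) *\<^sub>R closest_point L x + (s / r / ?c) *\<^sub>R ?y \<in> L"
    using c r s by (intro convexD[OF convex_L closest_in y]) (simp_all del: divide_divide_eq_left)
  moreover have "x = ?c *\<^sub>R ((1 / ?c) *\<^sub>R closest_point L x + (s / r / ?c) *\<^sub>R ?y)"
    using c r s by (simp add: scaleR_add_right)
  ultimately show "x \<in> (\<lambda>x. ?c *\<^sub>R x) ` L" by blast
qed

text \<open>The body \<open>L\<close> thickened by \<open>s > 0\<close> contains a ball of radius \<open>s\<close> touching each of its boundary
  points from inside; this rolling ball absorbs the part of the collar outside the dilated body,
  at the cost of a correction of second order in \<open>\<epsilon>\<close>.\<close>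

lemma collar_subset_scaled_parallel:
  assumes r: "0 < r" and h: "\<And>u. u \<in> sphere 0 1 \<Longrightarrow> r \<le> support_fun L u \<and> support_fun L u \<le> R"
    and R: "\<And>x. x \<in> L \<Longrightarrow> norm x \<le> R"
    and s: "0 < s" and \<epsilon>: "0 < \<epsilon>" and C: "C = 5 * R\<^sup>2 / (2 * s * r)" and \<epsilon>1: "C * \<epsilon> \<le> 1"
  shows "collar (support_fun L) s \<epsilon> \<subseteq> (\<lambda>x. (1 + (\<epsilon> + C * \<epsilon>\<^sup>2)) *\<^sub>R x) ` {x. infdist x L \<le> s}"
proof
  fix x assume x: "x \<in> collar (support_fun L) s \<epsilon>"
  let ?u = "outer_dir L x" and ?p = "closest_point L x" and ?r = "infdist x L"
  let ?h = "support_fun L ?u" and ?e = "\<epsilon> + C * \<epsilon>\<^sup>2"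
  have rr: "s < ?r" "?r \<le> s + \<epsilon> * ?h" using x by (auto simp: collar_def)
  have nu: "norm ?u = 1" using norm_outer_dir[of x] rr s by linarith
  have hh: "r \<le> ?h" "?h \<le> R" using h[of ?u] nu by auto
  have pR: "norm ?p \<le> R" by (rule R[OF closest_in])
  have C0: "0 \<le> C" using r s by (simp add: C)
  have e0: "0 < ?e" using \<epsilon> C0 by (simp add: add_pos_nonneg)
  have "\<epsilon> * (C * \<epsilon>) \<le> \<epsilon> * 1" using \<epsilon> \<epsilon>1 by (intro mult_left_mono) auto
  then have e2: "?e \<le> 2 * \<epsilon>" by (simp add: power2_eq_square mult_ac)
  have "(norm (?r *\<^sub>R ?u - ?e *\<^sub>R ?p))\<^sup>2 = ?r\<^sup>2 - 2 * ?r * ?e * ?h + ?e\<^sup>2 * (norm ?p)\<^sup>2"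
  proof -
    have "(?r *\<^sub>R ?u - ?e *\<^sub>R ?p) \<bullet> (?r *\<^sub>R ?u - ?e *\<^sub>R ?p)
        = ?r * ?r * (?u \<bullet> ?u) - 2 * ?r * ?e * (?p \<bullet> ?u) + ?e * ?e * (?p \<bullet> ?p)"
      by (simp only: inner_diff_left inner_diff_right inner_scaleR_left inner_scaleR_right
          inner_commute[of ?u ?p]) (simp add: algebra_simps)
    then show ?thesis
      unfolding outer_dir_supports using nu by (simp add: dot_square_norm power2_eq_square)
  qed
  \<comment> \<open>Write e for \<open>?e\<close>. The first-order terms 2 s \<epsilon> h cancel.
    There remain \<epsilon>^2 h^2 and e^2 |p|^2, together at most (1 + 4) \<epsilon>^2 R^2, since h
    and |p| are at most R and e \<le> 2 \<epsilon>. The summand C \<epsilon>^2 of e contributes -2 s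
    C \<epsilon>^2 h, which absorbs them because h \<ge> r; this fixes the constant C with its
    factor 5.\<close>
  also have "\<dots> \<le> s\<^sup>2"
  proof -
    have "?r\<^sup>2 \<le> (s + \<epsilon> * ?h)\<^sup>2" using rr s by (intro power_mono) auto
    moreover have "s * (?e * ?h) \<le> ?r * (?e * ?h)"
      using rr e0 hh r by (intro mult_right_mono) auto
    moreover have "?e\<^sup>2 * (norm ?p)\<^sup>2 \<le> (2 * \<epsilon>)\<^sup>2 * R\<^sup>2"
      using e0 e2 pR by (intro mult_mono power_mono) auto
    moreover have "(\<epsilon> * ?h)\<^sup>2 \<le> \<epsilon>\<^sup>2 * R\<^sup>2"
      using \<epsilon> hh r unfolding power_mult_distrib by (intro mult_left_mono power_mono) auto
    moreover have "5 * (\<epsilon>\<^sup>2 * R\<^sup>2) \<le> 2 * s * (C * \<epsilon>\<^sup>2) * ?h"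
    proof -
      have "2 * s * (C * \<epsilon>\<^sup>2) * r \<le> 2 * s * (C * \<epsilon>\<^sup>2) * ?h"
        using s C0 hh by (intro mult_left_mono) auto
      moreover have "2 * s * (C * \<epsilon>\<^sup>2) * r = 5 * (\<epsilon>\<^sup>2 * R\<^sup>2)" using s r by (simp add: C)
      ultimately show ?thesis by simp
    qed
    ultimately show ?thesis by (simp add: power2_sum algebra_simps power_mult_distrib)
  qed
  finally have n1: "norm (?r *\<^sub>R ?u - ?e *\<^sub>R ?p) \<le> s" using s by (simp add: abs_le_square_iff[symmetric])
  let ?y = "(1 / (1 + ?e)) *\<^sub>R x"
  have "?y - ?p = (1 / (1 + ?e)) *\<^sub>R (x - (1 + ?e) *\<^sub>R ?p)"
    using e0 by (simp add: scaleR_diff_right)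
  also have "x - (1 + ?e) *\<^sub>R ?p = ?r *\<^sub>R ?u - ?e *\<^sub>R ?p"
    by (subst decompose[of x]) (simp add: scaleR_add_left)
  finally have "norm (?y - ?p) = norm (?r *\<^sub>R ?u - ?e *\<^sub>R ?p) / (1 + ?e)"
    using e0 by simp
  also have "\<dots> \<le> s / (1 + ?e)" using n1 e0 by (intro divide_right_mono) auto
  also have "\<dots> \<le> s / 1" using s e0 by (intro divide_left_mono) auto
  finally have "infdist ?y L \<le> s"
    using infdist_le[OF closest_in, of ?y x] by (simp add: dist_norm)
  moreover have "x = (1 + ?e) *\<^sub>R ?y" using e0 by simp
  ultimately show "x \<in> (\<lambda>x. (1 + ?e) *\<^sub>R x) ` {x. infdist x L \<le> s}" by blast
qed

lemma integral_support_fun_self: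
  assumes int: "0 \<in> interior L"
  shows "(\<integral>u. support_fun L u \<partial>surface_area_measure L) = real DIM('a) * measure lebesgue L"
proof (rule antisym)
  let ?n = "DIM('a)"
  let ?I = "\<integral>u. support_fun L u \<partial>surface_area_measure L"
  have powa: "root ?n (measure lebesgue L) ^ ?n = measure lebesgue L" by (intro real_root_pow_pos2) auto
  \<comment> \<open>Minkowski's first inequality with K = L already gives this direction.\<close>
  have "real ?n * root ?n (measure lebesgue L) ^ (?n - 1) * root ?n (measure lebesgue L) \<le> ?I"
    using int by (intro minkowski_first compact_L convex_L) auto
  moreover have "root ?n (measure lebesgue L) ^ (?n - 1) * root ?n (measure lebesgue L) = measure lebesgue L"
    using powa power_minus_mult[of ?n "root ?n (measure lebesgue L)"] by simp
  ultimately show "real ?n * measure lebesgue L \<le> ?I" by (simp only: mult.assoc)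
  obtain r R where rR: "0 < r" "cball 0 r \<subseteq> L" "\<And>x. x \<in> L \<Longrightarrow> norm x \<le> R"
    "\<And>u. u \<in> sphere 0 1 \<Longrightarrow> r \<le> support_fun L u \<and> support_fun L u \<le> R"
    using support_fun_bounds[OF compact_L int] by metis
  have h: "support_fun L \<in> borel_measurable borel"
    using compact_L nonempty_L by (rule measurable_support_fun)
  have bd: "0 \<le> support_fun L u \<and> support_fun L u \<le> R" if "u \<in> sphere 0 1" for u
    using rR(1) rR(4)[OF that] by linarith
  have zero: "0 \<in> L" using rR(1,2) by auto
  have le_s: "?I \<le> real ?n * ((1 + s / r) ^ ?n * measure lebesgue L)" if s: "0 < s" for s
  proof -
    let ?M = "{x. infdist x L \<le> s}"
    define C where "C = 5 * R\<^sup>2 / (2 * s * r)"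
    let ?g = "\<lambda>\<epsilon>. (1 + (\<epsilon> + C * \<epsilon>\<^sup>2)) ^ ?n"
    have M: "?M \<in> lmeasurable" by (rule lmeasurable_region) auto
    have comp: "compact ?M" by (intro compact_infdist_le compact_L nonempty_L s)
    have C0: "0 \<le> C" using rR s by (simp add: C_def)
    have step: "?I \<le> (?g (0 + \<epsilon>) - ?g 0) / \<epsilon> * measure lebesgue ?M" if \<epsilon>: "0 < \<epsilon>" "C * \<epsilon> \<le> 1" for \<epsilon>
    proof -
      let ?c = "1 + (\<epsilon> + C * \<epsilon>\<^sup>2)"
      have c1: "1 \<le> ?c" using \<epsilon> C0 by simp
      have sub: "collar (support_fun L) s \<epsilon> \<subseteq> (\<lambda>x. ?c *\<^sub>R x) ` ?M"
        by (rule collar_subset_scaled_parallel[OF rR(1,4,3) s \<epsilon>(1) C_def \<epsilon>(2)])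
      \<comment> \<open>As the origin lies in L, shrinking x together with its nearest point keeps
        the latter in L and does not increase the distance.\<close>
      have sub2: "?M \<subseteq> (\<lambda>x. ?c *\<^sub>R x) ` ?M"
      proof
        fix x assume x: "x \<in> ?M"
        have "norm ((1 / ?c) *\<^sub>R x - (1 / ?c) *\<^sub>R closest_point L x) \<le> s"
        proof -
          have "norm ((1 / ?c) *\<^sub>R x - (1 / ?c) *\<^sub>R closest_point L x) = infdist x L / ?c"
            using c1 by (simp add: scaleR_diff_right[symmetric] infdist_eq)
          also have "\<dots> \<le> infdist x L / 1" using c1 by (intro divide_left_mono infdist_nonneg) auto
          finally show ?thesis using x by simp
        qed
        then have "infdist ((1 / ?c) *\<^sub>R x) L \<le> s"
          using infdist_le[OF scaled_in[OF zero closest_in c1], of "(1 / ?c) *\<^sub>R x" x] by (simp add: dist_norm)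
        moreover have "x = ?c *\<^sub>R ((1 / ?c) *\<^sub>R x)" using c1 by simp
        ultimately show "x \<in> (\<lambda>x. ?c *\<^sub>R x) ` ?M" by blast
      qed
      have Cm: "collar (support_fun L) s \<epsilon> \<in> lmeasurable"
        using \<epsilon> s bd by (intro collar_lmeasurable[OF h, of R]) auto
      have "?M \<inter> collar (support_fun L) s \<epsilon> = {}" by (auto simp: collar_def)
      then have "measure lebesgue ?M + measure lebesgue (collar (support_fun L) s \<epsilon>)
          = measure lebesgue (?M \<union> collar (support_fun L) s \<epsilon>)"
        using measure_Un3[OF M Cm] by simp
      also have "\<dots> \<le> measure lebesgue ((\<lambda>x. ?c *\<^sub>R x) ` ?M)"
        using sub sub2
        by (intro measure_mono_fmeasurable[OF _ fmeasurableD[OF fmeasurable.Un[OF M Cm]]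
              lmeasurable_compact[OF compact_scaling[OF comp]]] Un_least)
      also have "\<dots> = ?c ^ ?n * measure lebesgue ?M" using c1 by (intro measure_scaled) auto
      finally have "measure lebesgue (collar (support_fun L) s \<epsilon>) \<le> (?c ^ ?n - 1) * measure lebesgue ?M"
        by (simp add: algebra_simps)
      moreover have "\<epsilon> * ?I \<le> measure lebesgue (collar (support_fun L) s \<epsilon>)"
        using s \<epsilon> by (intro integral_le_collar[OF h bd]) auto
      ultimately have "\<epsilon> * ?I \<le> (?c ^ ?n - 1) * measure lebesgue ?M" by linarith
      then show ?thesis using \<epsilon> by (simp add: field_simps)
    qed
    \<comment> \<open>The derivative at 0 is n whatever C is, so the growth of C for small s does no
      harm when s tends to 0 later.\<close>
    have "(?g has_field_derivative real ?n) (at 0)"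
      by (auto intro!: derivative_eq_intros)
    then have "((\<lambda>\<epsilon>. (?g (0 + \<epsilon>) - ?g 0) / \<epsilon>) \<longlongrightarrow> real ?n) (at_right 0)"
      unfolding DERIV_def by (rule tendsto_mono[OF at_le[OF subset_UNIV]])
    then have lim: "((\<lambda>\<epsilon>. (?g (0 + \<epsilon>) - ?g 0) / \<epsilon> * measure lebesgue ?M) \<longlongrightarrow> real ?n * measure lebesgue ?M) (at_right 0)"
      by (intro tendsto_mult tendsto_const)
    have "((\<lambda>\<epsilon>. C * \<epsilon>) \<longlongrightarrow> C * 0) (at_right 0)" by (intro tendsto_intros)
    then have "\<forall>\<^sub>F \<epsilon> in at_right 0. C * \<epsilon> < 1" by (rule order_tendstoD(2)) simp
    with eventually_at_right_less[of "0::real"]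
    have "\<forall>\<^sub>F \<epsilon> in at_right 0. ?I \<le> (?g (0 + \<epsilon>) - ?g 0) / \<epsilon> * measure lebesgue ?M"
      by eventually_elim (rule step, auto)
    then have "?I \<le> real ?n * measure lebesgue ?M"
      by (rule tendsto_lowerbound[OF lim]) simp
    also have "measure lebesgue ?M \<le> measure lebesgue ((\<lambda>x. (1 + s / r) *\<^sub>R x) ` L)"
      using parallel_subset_scaled[OF rR(1,2) s]
      by (intro measure_mono_fmeasurable[OF _ fmeasurableD[OF M]] lmeasurable_compact compact_scaling compact_L)
    also have "\<dots> = (1 + s / r) ^ ?n * measure lebesgue L"
      using rR s by (intro measure_scaled) auto
    finally show ?thesis by simp
  qed
  have "((\<lambda>s. real ?n * ((1 + s / r) ^ ?n * measure lebesgue L)) \<longlongrightarrow> real ?n * ((1 + 0 / r) ^ ?n * measure lebesgue L)) (at_right 0)"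
    using rR(1) by (intro tendsto_intros) auto
  moreover have "\<forall>\<^sub>F s in at_right 0. ?I \<le> real ?n * ((1 + s / r) ^ ?n * measure lebesgue L)"
    using eventually_at_right_less[of "0::real"] by (rule eventually_mono) (rule le_s)
  ultimately have "?I \<le> real ?n * ((1 + 0 / r) ^ ?n * measure lebesgue L)"
    by (rule tendsto_lowerbound) simp
  then show "?I \<le> real ?n * measure lebesgue L" by simp
qed

end

subsection \<open>The logarithmic inequality\<close>

lemma integral_scale_density:
  fixes f :: "'a \<Rightarrow> real"
  assumes f: "f \<in> borel_measurable M" and g: "g \<in> borel_measurable M" "AE x in M. 0 \<le> g x" and c: "0 \<le> c"
  shows "(\<integral>x. f x \<partial>scale_measure (ennreal c) (density M (\<lambda>x. ennreal (g x)))) = c * (\<integral>x. g x * f x \<partial>M)"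
proof -
  let ?D = "density M (\<lambda>x. ennreal (g x))"
  have "scale_measure (ennreal c) ?D = density ?D (\<lambda>x. ennreal c)"
    by (rule measure_eqI) (simp_all add: emeasure_density_const)
  then have "(\<integral>x. f x \<partial>scale_measure (ennreal c) ?D) = (\<integral>x. c *\<^sub>R f x \<partial>?D)"
    using f c by (simp add: integral_density)
  also have "\<dots> = c * (\<integral>x. f x \<partial>?D)" by simp
  also have "\<dots> = c * (\<integral>x. g x * f x \<partial>M)" using f g by (simp add: integral_density)
  finally show ?thesis .
qed

text \<open>The bound ln z \<le> z - 1 at z = 1/t with its equality case, written as a nonnegative
  gap so that a vanishing integral forces t = 1 almost everywhere.\<close>

lemma ln_gap:
  fixes t :: real
  assumes "0 < t"
  shows "0 \<le> ln t - 1 + 1 / t" and "ln t - 1 + 1 / t = 0 \<longleftrightarrow> t = 1"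
proof -
  have "ln (1 / t) = - ln t" using assms by (simp add: ln_div)
  then show "0 \<le> ln t - 1 + 1 / t" using ln_le_minus_one[of "1 / t"] assms by simp
  show "ln t - 1 + 1 / t = 0 \<longleftrightarrow> t = 1"
  proof
    assume "ln t - 1 + 1 / t = 0"
    then have "ln (1 / t) = 1 / t - 1" using \<open>ln (1 / t) = - ln t\<close> by simp
    then have "1 / t = 1" using assms by (intro ln_eq_minus_one) auto
    then show "t = 1" by simp
  qed simp
qed

lemma compact_convexI: "convex_body L \<Longrightarrow> 0 \<in> interior L \<Longrightarrow> compact_convex L"
  using interior_subset[of L] by (auto simp: convex_body_def compact_convex_def)

lemma support_fun_pos:
  "compact K \<Longrightarrow> 0 \<in> interior K \<Longrightarrow> u \<in> sphere 0 1 \<Longrightarrow> 0 < support_fun K u"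
  by (metis support_fun_bounds less_le_trans)

context compact_convex
begin

lemma integrable_continuous:
  fixes f :: "'a \<Rightarrow> real"
  assumes "f \<in> borel_measurable borel" "continuous_on (sphere 0 1) f"
  shows "integrable (surface_area_measure L) f"
proof -
  have "bounded (f ` sphere 0 1)"
    by (intro compact_imp_bounded compact_continuous_image assms compact_sphere)
  then obtain R where "\<forall>u\<in>sphere 0 1. \<bar>f u\<bar> \<le> R" by (auto simp: bounded_iff)
  then show ?thesis using assms(1) by (intro integrable_surface) blast+
qed

lemma measure_pos: "interior L \<noteq> {} \<Longrightarrow> 0 < measure lebesgue L"
  using measure_open_pos[OF open_interior 
        lmeasurable_open[OF bounded_interior[OF compact_imp_bounded[OF compact_L]] open_interior]]
    measure_interior_convex[OF convex_L compact_imp_bounded[OF compact_L]] by simp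

lemma mixed_volume_ge:
  assumes "interior L \<noteq> {}" "compact K" "convex K" "0 \<in> interior K"
  shows "root DIM('a) (measure lebesgue L) ^ (DIM('a) - 1) * root DIM('a) (measure lebesgue K) \<le> mixed_volume L K"
proof -
  have "0 < real DIM('a)" by simp
  then show ?thesis
    using minkowski_first[OF assms] unfolding mixed_volume_def
    by (simp add: field_simps)
qed

lemma log_minkowski_gap:
  assumes K: "compact K" "0 \<in> interior K" and L: "0 \<in> interior L"
    and V: "0 < mixed_volume L K" and VL: "0 < measure lebesgue L"
  defines "l \<equiv> mixed_volume L K / measure lebesgue L"
    and "I \<equiv> \<integral>u. ln (support_fun K u / support_fun L u) \<partial>normalized_mixed_volume_measure L K"
  shows "ln l \<le> I" and "I = ln l \<longleftrightarrow> (AE u in surface_area_measure L. support_fun K u = l * support_fun L u)"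
proof -
  let ?S = "surface_area_measure L" and ?n = "real DIM('a)"
  let ?h = "support_fun K" and ?k = "support_fun L"
  have ne: "K \<noteq> {}" using K(2) interior_subset by auto
  have [measurable]: "?h \<in> borel_measurable borel" "?k \<in> borel_measurable borel"
    using K(1) ne compact_L nonempty_L by (auto intro: measurable_support_fun)
  have hpos: "0 < ?h u" and kpos: "0 < ?k u" if "u \<in> sphere 0 1" for u
    using that K L compact_L by (auto intro!: support_fun_pos simp del: mem_sphere)
  have [continuous_intros]: "continuous_on (sphere 0 1) ?h" "continuous_on (sphere 0 1) ?k"
    using K(1) ne compact_L nonempty_L by (auto intro: continuous_on_support_fun)
  have cont: "continuous_on (sphere 0 1) (\<lambda>u. ?h u * ln (?h u / ?k u))"
    using hpos kpos by (intro continuous_intros) (metis less_irrefl divide_pos_pos)+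
  have inth: "integrable ?S ?h" "integrable ?S ?k"
    by (auto intro!: integrable_continuous continuous_intros)
  have intl: "integrable ?S (\<lambda>u. ?h u * ln (?h u / ?k u))"
    by (intro integrable_continuous cont) measurable
  have Sspace: "AE u in ?S. u \<in> sphere 0 1"
    by (rule AE_I2) simp
  have l: "0 < l" unfolding l_def using V VL by simp
  have V1: "(\<integral>u. ?h u \<partial>?S) = ?n * mixed_volume L K" by (simp add: mixed_volume_def)
  have VLL: "(\<integral>u. ?k u \<partial>?S) = ?n * measure lebesgue L" by (rule integral_support_fun_self[OF L])
  have "I = 1 / mixed_volume L K * (\<integral>u. (1 / ?n * ?h u) * ln (?h u / ?k u) \<partial>?S)"
    unfolding I_def normalized_mixed_volume_measure_def mixed_volume_measure_def
  proof (rule integral_scale_density)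
    show "(\<lambda>u. ln (?h u / ?k u)) \<in> borel_measurable ?S" by (rule measurable_surface) measurable
    show "(\<lambda>u. 1 / ?n * ?h u) \<in> borel_measurable ?S" by (rule measurable_surface) measurable
    show "AE u in ?S. 0 \<le> 1 / ?n * ?h u"
      using Sspace
    proof eventually_elim
      case (elim u)
      then show ?case using less_imp_le[OF hpos[OF elim]] by simp
    qed
  qed (use V in simp)
  also have "(\<integral>u. (1 / ?n * ?h u) * ln (?h u / ?k u) \<partial>?S) = 1 / ?n * (\<integral>u. ?h u * ln (?h u / ?k u) \<partial>?S)"
    by (simp only: mult.assoc integral_mult_right_zero)
  finally have I: "?n * mixed_volume L K * I = (\<integral>u. ?h u * ln (?h u / ?k u) \<partial>?S)"
    using V by simp
  \<comment> \<open>This is h_K (ln t - 1 + 1/t) for t = h_K / (l h_L), multiplied out. The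
    non-logarithmic part integrates to 0: the integral of h_K is n V_1(L,K), and l times that of h_L
    is l n Vol(L), the same number by the choice of l.\<close>
  let ?g = "\<lambda>u. ?h u * ln (?h u / ?k u) - (ln l + 1) * ?h u + l * ?k u"
  have intg: "integrable ?S ?g" using inth intl by auto
  have "(\<integral>u. ?g u \<partial>?S) = ?n * mixed_volume L K * I - (ln l + 1) * (?n * mixed_volume L K) + l * (?n * measure lebesgue L)"
    using inth intl by (simp add: I V1 VLL)
  also have "l * (?n * measure lebesgue L) = ?n * mixed_volume L K" using VL by (simp add: l_def)
  finally have G: "(\<integral>u. ?g u \<partial>?S) = ?n * mixed_volume L K * (I - ln l)" by (simp add: algebra_simps)
  have g: "0 \<le> ?g u \<and> (?g u = 0 \<longleftrightarrow> ?h u = l * ?k u)" if u: "u \<in> sphere 0 1" for u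
  proof -
    let ?t = "?h u / (l * ?k u)"
    have p: "0 < ?h u" "0 < ?k u" by (rule hpos[OF u], rule kpos[OF u])
    then have t: "0 < ?t" using l by simp
    have lnt: "ln ?t = ln (?h u / ?k u) - ln l" using p l by (simp add: ln_div ln_mult)
    have eq: "?g u = ?h u * (ln ?t - 1 + 1 / ?t)" unfolding lnt using p l by (simp add: field_simps)
    have "?t = 1 \<longleftrightarrow> ?h u = l * ?k u" using p l by auto
    then show ?thesis unfolding eq using ln_gap[OF t] p(1) by simp
  qed
  have gAE: "AE u in ?S. 0 \<le> ?g u" using Sspace by eventually_elim (use g in blast)
  have "0 \<le> ?n * mixed_volume L K * (I - ln l)"
    unfolding G[symmetric] by (rule integral_nonneg_AE[OF gAE])
  moreover have nV: "0 < ?n * mixed_volume L K" using V by simp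
  ultimately show "ln l \<le> I" by (simp add: zero_le_mult_iff)
  have "I = ln l \<longleftrightarrow> (\<integral>u. ?g u \<partial>?S) = 0" unfolding G using V by simp
  also have "\<dots> \<longleftrightarrow> (AE u in ?S. ?g u = 0)" by (rule integral_nonneg_eq_0_iff_AE[OF intg gAE])
  also have "\<dots> \<longleftrightarrow> (AE u in ?S. ?h u = l * ?k u)"
    by (rule AE_cong) (use g in \<open>simp del: mem_sphere\<close>)
  finally show "I = ln l \<longleftrightarrow> (AE u in ?S. ?h u = l * ?k u)" .
qed

text \<open>The convex hull of \<open>K \<union> l L\<close> has the same support function as \<open>l L\<close> almost everywhere, so by
  Minkowski's first inequality it is no larger than \<open>l L\<close>.\<close>

lemma eq_scaled_of_support_fun_AE:
  assumes K: "compact K" "convex K" "0 \<in> interior K" and L: "0 \<in> interior L" and l: "0 < l"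
    and ae: "AE u in surface_area_measure L. support_fun K u = l * support_fun L u"
    and vol: "measure lebesgue K = l ^ DIM('a) * measure lebesgue L"
  shows "K = (\<lambda>x. l *\<^sub>R x) ` L"
proof -
  let ?n = "DIM('a)" and ?S = "surface_area_measure L"
  let ?lL = "(\<lambda>x. l *\<^sub>R x) ` L"
  define H where "H = convex hull (K \<union> ?lL)"
  have clL: "compact ?lL" using compact_L by (rule compact_scaling)
  have H: "compact H" "convex H" 
    unfolding H_def using K(1) clL by (auto intro: compact_convex_hull compact_Un)
  have sub: "K \<subseteq> H" "?lL \<subseteq> H" unfolding H_def using hull_subset[of "K \<union> ?lL" convex] by auto
  then have H0: "0 \<in> interior H" using interior_mono[of K H] K(3) by auto
  have ne: "H \<noteq> {}" using H0 interior_subset by auto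
  have le: "support_fun H u \<le> l * support_fun L u" if u: "support_fun K u = l * support_fun L u" for u
  proof (rule support_fun_le[OF ne])
    fix x assume "x \<in> H"
    have "K \<union> ?lL \<subseteq> {x. x \<bullet> u \<le> l * support_fun L u}"
    proof
      fix y assume "y \<in> K \<union> ?lL"
      then show "y \<in> {x. x \<bullet> u \<le> l * support_fun L u}"
      proof
        assume "y \<in> K"
        then show ?thesis using inner_le_support_fun[OF K(1), of y u] u by simp
      next
        assume "y \<in> ?lL"
        then show ?thesis
          using inner_le_support_fun[OF clL, of y u] support_fun_scale[OF compact_L nonempty_L l, of u] by simp
      qed
    qed
    then have "H \<subseteq> {x. x \<bullet> u \<le> l * support_fun L u}"
      unfolding H_def using convex_halfspace_le[of u "l * support_fun L u"]
      by (intro hull_minimal) (simp_all add: inner_commute)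
    then show "x \<bullet> u \<le> l * support_fun L u" using \<open>x \<in> H\<close> by auto
  qed
  have "(\<integral>u. support_fun H u \<partial>?S) \<le> (\<integral>u. l * support_fun L u \<partial>?S)"
  proof (rule integral_mono_AE)
    show "integrable ?S (support_fun H)" "integrable ?S (\<lambda>u. l * support_fun L u)"
      using H ne compact_L nonempty_L
      by (auto intro!: integrable_mult_right integrable_continuous measurable_support_fun continuous_on_support_fun)
    show "AE u in ?S. support_fun H u \<le> l * support_fun L u" using ae by eventually_elim (rule le)
  qed
  also have "\<dots> = l * (real ?n * measure lebesgue L)" by (simp add: integral_support_fun_self[OF L])
  finally have int: "(\<integral>u. support_fun H u \<partial>?S) \<le> l * (real ?n * measure lebesgue L)" .
  let ?a = "root ?n (measure lebesgue L)" and ?b = "root ?n (measure lebesgue H)"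
  have intL: "interior L \<noteq> {}" using L by auto
  have a: "0 < ?a" using measure_pos[OF intL] by simp
  have apow: "measure lebesgue L = ?a ^ (?n - 1) * ?a"
    using real_root_pow_pos2[of ?n "measure lebesgue L"] power_minus_mult[of ?n ?a] by simp
  have "real ?n * ?a ^ (?n - 1) * ?b \<le> l * (real ?n * measure lebesgue L)"
    using minkowski_first[OF intL H H0] int by linarith
  then have "(real ?n * ?a ^ (?n - 1)) * ?b \<le> (real ?n * ?a ^ (?n - 1)) * (l * ?a)"
    by (subst (asm) apow) (simp add: mult_ac)
  then have "?b \<le> l * ?a" using a by (subst (asm) mult_le_cancel_left_pos) auto
  then have "?b ^ ?n \<le> (l * ?a) ^ ?n" by (intro power_mono) auto
  then have "measure lebesgue H \<le> l ^ ?n * measure lebesgue L"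
    by (simp add: power_mult_distrib real_root_pow_pos2)
  moreover have "measure lebesgue ?lL = l ^ ?n * measure lebesgue L" using l by (intro measure_scaled) auto
  \<comment> \<open>By \<open>vol\<close> the body K has the same volume as the dilate of L, so both
    subsets of H have at least its volume and each fills it.\<close>
  ultimately have "measure lebesgue H \<le> measure lebesgue K" "measure lebesgue H \<le> measure lebesgue ?lL"
    using vol by simp_all
  moreover have "interior H \<noteq> {}" using H0 by auto
  ultimately have "K = H" "?lL = H"
    using compact_convex_eqI[OF K(1) H _ sub(1)] compact_convex_eqI[OF clL H _ sub(2)] by blast+
  then show ?thesis by simp
qed

end

section \<open>The two inequalities and their common equality case\<close>

theorem proposition1p1:
  fixes K L :: "'a::euclidean_space set"
  assumes "convex_body K" and "0 \<in> interior K"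
    and "convex_body L" and "0 \<in> interior L"
  shows "(\<integral>u. ln (support_fun K u / support_fun L u) \<partial>normalized_mixed_volume_measure L K)
           \<ge> ln (mixed_volume L K / Vol L)
       \<and> ln (mixed_volume L K / Vol L) \<ge> 1 / real DIM('a) * ln (Vol K / Vol L)
       \<and> (((\<integral>u. ln (support_fun K u / support_fun L u) \<partial>normalized_mixed_volume_measure L K)
              = ln (mixed_volume L K / Vol L)
            \<and> ln (mixed_volume L K / Vol L) = 1 / real DIM('a) * ln (Vol K / Vol L))
           \<longleftrightarrow> homothetic K L)"
proof -
  interpret K: compact_convex K using assms by (intro compact_convexI)
  interpret L: compact_convex L using assms by (intro compact_convexI)
  let ?n = "DIM('a)"
  let ?a = "root ?n (Vol L)" and ?b = "root ?n (Vol K)" and ?l = "mixed_volume L K / Vol L"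
  have VL: "0 < Vol L" using assms by (intro L.measure_pos) auto
  have VK: "0 < Vol K" using assms by (intro K.measure_pos) auto
  have ab: "0 < ?a" "0 < ?b" using VL VK by simp_all
  have V: "?a ^ (?n - 1) * ?b \<le> mixed_volume L K"
    using assms by (intro L.mixed_volume_ge K.compact_L K.convex_L) auto
  moreover have "0 < ?a ^ (?n - 1) * ?b" using ab by simp
  ultimately have Vpos: "0 < mixed_volume L K" by linarith
  have lpos: "0 < ?l" using Vpos VL by simp
  note gap = L.log_minkowski_gap[OF K.compact_L assms(2,4) Vpos VL]
  have lnab: "1 / real ?n * ln (Vol K / Vol L) = ln (?b / ?a)"
    using VL VK ab by (simp add: ln_div ln_root diff_divide_distrib)
  have VLeq: "?a ^ (?n - 1) * ?a = Vol L"
    using real_root_pow_pos2[of ?n "Vol L"] power_minus_mult[of ?n ?a] by simp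
  \<comment> \<open>This quotient is the n-th root of Vol(K)/Vol(L), so the second inequality is the
    logarithm of Minkowski's inequality divided by Vol(L) = a^n.\<close>
  have "?b / ?a = (?a ^ (?n - 1) * ?b) / (?a ^ (?n - 1) * ?a)" using ab by simp
  also have "\<dots> = ?a ^ (?n - 1) * ?b / Vol L" by (simp only: VLeq)
  also have "\<dots> \<le> ?l" using V VL by (intro divide_right_mono) auto
  finally have ba: "?b / ?a \<le> ?l" .
  have second: "1 / real ?n * ln (Vol K / Vol L) \<le> ln ?l"
    unfolding lnab using ba ab lpos by (intro ln_mono) auto
  \<comment> \<open>The two equalities serve different ends: the second fixes the volume of K as l^n
    Vol(L), the first makes the support functions proportional almost everywhere.\<close>
  have "homothetic K L" if eq: "(\<integral>u. ln (support_fun K u / support_fun L u) \<partial>normalized_mixed_volume_measure L K) = ln ?l"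
    "ln ?l = 1 / real ?n * ln (Vol K / Vol L)"
  proof -
    have "?l = ?b / ?a" using eq(2) lpos ab unfolding lnab by simp
    then have "?l ^ ?n = Vol K / Vol L" using VL VK by (simp only: power_divide real_root_pow_pos DIM_positive)
    then have "Vol K = ?l ^ ?n * Vol L" using VL by simp
    then have "K = (\<lambda>x. ?l *\<^sub>R x) ` L"
      using gap(2) eq(1) assms lpos K.compact_L K.convex_L
      by (intro L.eq_scaled_of_support_fun_AE) auto
    then show ?thesis using lpos unfolding homothetic_def by blast
  qed
  moreover have "(\<integral>u. ln (support_fun K u / support_fun L u) \<partial>normalized_mixed_volume_measure L K) = ln ?l
    \<and> ln ?l = 1 / real ?n * ln (Vol K / Vol L)" if hom: "homothetic K L"
  proof -
    obtain c where c: "0 < c" "K = (\<lambda>x. c *\<^sub>R x) ` L" using hom unfolding homothetic_def by blast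
    have h: "support_fun K u = c * support_fun L u" for u
      unfolding c(2) by (rule support_fun_scale[OF L.compact_L L.nonempty_L c(1)])
    \<comment> \<open>Linearity in K together with V_1(L,L) = Vol(L) identifies the factor l with
      the dilation c.\<close>
    have "mixed_volume L K = c * Vol L"
      unfolding mixed_volume_def h using L.integral_support_fun_self[OF assms(4)] by simp
    then have lc: "?l = c" using VL by simp
    have "Vol K = c ^ ?n * Vol L" unfolding c(2) using c(1) by (intro measure_scaled) auto
    then have "1 / real ?n * ln (Vol K / Vol L) = ln ?l"
      unfolding lc using c(1) VL by (simp add: ln_realpow)
    moreover have "(\<integral>u. ln (support_fun K u / support_fun L u) \<partial>normalized_mixed_volume_measure L K) = ln ?l"
    proof (rule gap(2)[THEN iffD2])
      show "AE u in surface_area_measure L. support_fun K u = ?l * support_fun L u" unfolding lc h by simp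
    qed
    ultimately show ?thesis by simp
  qed
  ultimately show ?thesis using gap(1) second by blast
qed

end
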